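(* Let $\Gamma$ be a finite connected nontrivial graph and $G\leqslant \mathrm{Aut}(\Gamma)$ such that $\Gamma$ is $G$-edge-primitive. Then $\Gamma$ is $G$-arc-transitive, and one of the following holds: (1) $\Gamma$ is $G$-vertex-primitive; (2) $\Gamma$ is $G$-vertex-biprimitive; (3) $\Gamma$ is a spread of a $G$-edge-primitive graph which is $G$-locally imprimitive. Conversely, if $\Sigma$ is a $G$-edge-primitive, $G$-locally imprimitive graph, then $\Sigma$ is a quotient graph $\Gamma_{\mathcal{B}}$ of a larger $G$-edge-primitive graph $\Gamma$ (for some $G$-invariant partition $\mathcal{B}$ of $V\Gamma$) with $G^{E\Sigma}\cong G^{E\Gamma}$.
   Context: All graphs are finite and simple. For a graph $\Gamma$, $V\Gamma$, $E\Gamma$ denote the vertex and edge sets and $\Gamma(v)$ the set of neighbours of $v$. For $G\leqslant\mathrm{Aut}(\Gamma)$, $G^{E\Gamma}$ denotes the permutation group induced by $G$ on $E\Gamma$. $\Gamma$ is $G$-edge-primitive if $G$ acts primitively on $E\Gamma$; $G$-vertex-primitive if $G$ acts primitively on $V\Gamma$; $G$-arc-transitive if $G$ is transitive on ordered pairs of adjacent vertices. A transitive permutation group is biprimitive if it is imprimitive and every nontrivial system of imprimitivity has exactly two parts; $\Gamma$ is $G$-vertex-biprimitive if $G$ is biprimitive on $V\Gamma$. $\Gamma$ is $G$-locally imprimitive if the vertex stabiliser $G_v$ acts imprimitively on $\Gamma(v)$ for each vertex $v$. A graph is called trivial if it is a star $K_{1,n}$ or a cycle $C_p$ of prime length $p$.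 For a $G$-arc-transitive graph $\Gamma$ and a $G$-invariant partition $\mathcal{B}$ of $V\Gamma$, the quotient graph $\Gamma_{\mathcal{B}}$ has vertex set $\mathcal{B}$, with $B,C\in\mathcal{B}$ adjacent iff some edge $\{v,w\}$ of $\Gamma$ has $v\in B$, $w\in C$. $\Gamma$ is a spread of $\Gamma_{\mathcal{B}}$ if for each arc $(B,C)$ of $\Gamma_{\mathcal{B}}$ there is exactly one arc $(v,w)$ of $\Gamma$ with $v\in B$, $w\in C$. *)

theory Defs
  imports "HOL-Algebra.Group_Action" "HOL-Computational_Algebra.Primes" "HOL-Library.Disjoint_Sets"
    "Graph_Theory.Pair_Digraph" "Graph_Theory.Digraph_Component" "Graph_Theory.Kuratowski"
begin

text \<open>
  A finite simple graph is a \<^locale>\<open>pair_graph\<close>: a finite vertex set \<^const>\<open>pverts\<close> with a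
  symmetric, irreflexive set \<^const>\<open>parcs\<close> of ordered pairs of adjacent vertices.
  Group actions are those of \<^locale>\<open>group_action\<close>, so every action below is restricted
  to the set acted on.
\<close>

subsection \<open>Primitivity of group actions\<close>

text \<open>Invariant partitions are the systems of imprimitivity.\<close>

definition invariant_partition ::
    "('g, 'm) monoid_scheme \<Rightarrow> 'a set \<Rightarrow> ('g \<Rightarrow> 'a \<Rightarrow> 'a) \<Rightarrow> 'a set set \<Rightarrow> bool" where
  "invariant_partition G \<Omega> \<phi> P \<longleftrightarrow>
     partition_on \<Omega> P \<and> (\<forall>g\<in>carrier G. \<forall>B\<in>P. \<phi> g ` B \<in> P)"

definition nontrivial_system ::
    "('g, 'm) monoid_scheme \<Rightarrow> 'a set \<Rightarrow> ('g \<Rightarrow> 'a \<Rightarrow> 'a) \<Rightarrow> 'a set set \<Rightarrow> bool" where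
  "nontrivial_system G \<Omega> \<phi> P \<longleftrightarrow>
     invariant_partition G \<Omega> \<phi> P \<and> P \<noteq> {\<Omega>} \<and> P \<noteq> (\<lambda>x. {x}) ` \<Omega>"

text \<open>
  \<^locale>\<open>transitive_action\<close> admits the empty set, hence the explicit non-emptiness condition.
\<close>

definition primitive_action ::
    "('g, 'm) monoid_scheme \<Rightarrow> 'a set \<Rightarrow> ('g \<Rightarrow> 'a \<Rightarrow> 'a) \<Rightarrow> bool" where
  "primitive_action G \<Omega> \<phi> \<longleftrightarrow>
     \<Omega> \<noteq> {} \<and> transitive_action G \<Omega> \<phi> \<and> (\<nexists>P. nontrivial_system G \<Omega> \<phi> P)"

definition imprimitive_action ::
    "('g, 'm) monoid_scheme \<Rightarrow> 'a set \<Rightarrow> ('g \<Rightarrow> 'a \<Rightarrow> 'a) \<Rightarrow> bool" where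
  "imprimitive_action G \<Omega> \<phi> \<longleftrightarrow>
     \<Omega> \<noteq> {} \<and> transitive_action G \<Omega> \<phi> \<and> (\<exists>P. nontrivial_system G \<Omega> \<phi> P)"

definition biprimitive_action ::
    "('g, 'm) monoid_scheme \<Rightarrow> 'a set \<Rightarrow> ('g \<Rightarrow> 'a \<Rightarrow> 'a) \<Rightarrow> bool" where
  "biprimitive_action G \<Omega> \<phi> \<longleftrightarrow>
     imprimitive_action G \<Omega> \<phi> \<and> (\<forall>P. nontrivial_system G \<Omega> \<phi> P \<longrightarrow> card P = 2)"


subsection \<open>Graphs and their automorphism groups\<close>

definition edge_set :: "'v pair_pre_digraph \<Rightarrow> 'v set set" where
  "edge_set \<Gamma> = {{u, v} | u v. (u, v) \<in> parcs \<Gamma>}"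

definition nbrs :: "'v pair_pre_digraph \<Rightarrow> 'v \<Rightarrow> 'v set" where
  "nbrs \<Gamma> v = {w. (v, w) \<in> parcs \<Gamma>}"

definition is_star :: "'v pair_pre_digraph \<Rightarrow> bool" where
  "is_star \<Gamma> \<longleftrightarrow> (\<exists>n. K\<^bsub>1,n\<^esub> (with_proj \<Gamma>))"

definition is_cycle_graph :: "nat \<Rightarrow> 'v pair_pre_digraph \<Rightarrow> bool" where
  "is_cycle_graph n \<Gamma> \<longleftrightarrow> 3 \<le> n \<and>
     (\<exists>f. bij_betw f {0..<n} (pverts \<Gamma>) \<and>
        parcs \<Gamma> = {(f i, f j) | i j. i < n \<and> j < n \<and>
                     (j = (i + 1) mod n \<or> i = (j + 1) mod n)})"

definition trivial_graph :: "'v pair_pre_digraph \<Rightarrow> bool" where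
  "trivial_graph \<Gamma> \<longleftrightarrow> is_star \<Gamma> \<or> (\<exists>p::nat. prime p \<and> is_cycle_graph p \<Gamma>)"

definition AutGroup :: "'v pair_pre_digraph \<Rightarrow> ('v \<Rightarrow> 'v) monoid" where
  "AutGroup \<Gamma> = (BijGroup (pverts \<Gamma>))
     \<lparr>carrier := {g \<in> Bij (pverts \<Gamma>).
        \<forall>u\<in>pverts \<Gamma>. \<forall>v\<in>pverts \<Gamma>. (g u, g v) \<in> parcs \<Gamma> \<longleftrightarrow> (u, v) \<in> parcs \<Gamma>}\<rparr>"

text \<open>The group whose elements are the automorphisms in \<^term>\<open>G\<close>.\<close>

abbreviation aut_subgroup :: "'v pair_pre_digraph \<Rightarrow> ('v \<Rightarrow> 'v) set \<Rightarrow> ('v \<Rightarrow> 'v) monoid" where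
  "aut_subgroup \<Gamma> G \<equiv> (AutGroup \<Gamma>)\<lparr>carrier := G\<rparr>"


subsection \<open>Groups acting on graphs\<close>

text \<open>
  In the following a group \<^term>\<open>G\<close> acts on the vertices of \<^term>\<open>\<Gamma>\<close> by \<^term>\<open>\<phi>\<close>, so that
  one group can act on several graphs. A subgroup of the automorphism group acts by
  \<^term>\<open>\<lambda>g. g\<close>; in general \<open>G \<le> Aut \<Gamma>\<close> is expressed by \<^term>\<open>\<phi> \<in> mon G (AutGroup \<Gamma>)\<close>,
  i.e. \<^term>\<open>\<phi>\<close> is an injective homomorphism.
\<close>

definition edge_action ::
    "('g \<Rightarrow> 'v \<Rightarrow> 'v) \<Rightarrow> 'v pair_pre_digraph \<Rightarrow> 'g \<Rightarrow> 'v set \<Rightarrow> 'v set" where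
  "edge_action \<phi> \<Gamma> g = (\<lambda>e\<in>edge_set \<Gamma>. \<phi> g ` e)"

definition arc_action ::
    "('g \<Rightarrow> 'v \<Rightarrow> 'v) \<Rightarrow> 'v pair_pre_digraph \<Rightarrow> 'g \<Rightarrow> 'v \<times> 'v \<Rightarrow> 'v \<times> 'v" where
  "arc_action \<phi> \<Gamma> g = (\<lambda>a\<in>parcs \<Gamma>. (\<phi> g (fst a), \<phi> g (snd a)))"

definition local_action ::
    "('g \<Rightarrow> 'v \<Rightarrow> 'v) \<Rightarrow> 'v pair_pre_digraph \<Rightarrow> 'v \<Rightarrow> 'g \<Rightarrow> 'v \<Rightarrow> 'v" where
  "local_action \<phi> \<Gamma> v g = (\<lambda>w\<in>nbrs \<Gamma> v. \<phi> g w)"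

definition block_action ::
    "('g \<Rightarrow> 'v \<Rightarrow> 'v) \<Rightarrow> 'v set set \<Rightarrow> 'g \<Rightarrow> 'v set \<Rightarrow> 'v set" where
  "block_action \<phi> P g = (\<lambda>B\<in>P. \<phi> g ` B)"

definition induced_edge_group ::
    "('g, 'm) monoid_scheme \<Rightarrow> ('g \<Rightarrow> 'v \<Rightarrow> 'v) \<Rightarrow> 'v pair_pre_digraph
      \<Rightarrow> ('v set \<Rightarrow> 'v set) monoid" where
  "induced_edge_group G \<phi> \<Gamma> =
     (BijGroup (edge_set \<Gamma>))\<lparr>carrier := edge_action \<phi> \<Gamma> ` carrier G\<rparr>"

definition edge_primitive ::
    "('g, 'm) monoid_scheme \<Rightarrow> ('g \<Rightarrow> 'v \<Rightarrow> 'v) \<Rightarrow> 'v pair_pre_digraph \<Rightarrow> bool" where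
  "edge_primitive G \<phi> \<Gamma> \<longleftrightarrow> primitive_action G (edge_set \<Gamma>) (edge_action \<phi> \<Gamma>)"

definition arc_transitive ::
    "('g, 'm) monoid_scheme \<Rightarrow> ('g \<Rightarrow> 'v \<Rightarrow> 'v) \<Rightarrow> 'v pair_pre_digraph \<Rightarrow> bool" where
  "arc_transitive G \<phi> \<Gamma> \<longleftrightarrow> transitive_action G (parcs \<Gamma>) (arc_action \<phi> \<Gamma>)"

definition vertex_primitive ::
    "('g, 'm) monoid_scheme \<Rightarrow> ('g \<Rightarrow> 'v \<Rightarrow> 'v) \<Rightarrow> 'v pair_pre_digraph \<Rightarrow> bool" where
  "vertex_primitive G \<phi> \<Gamma> \<longleftrightarrow> primitive_action G (pverts \<Gamma>) \<phi>"

definition vertex_biprimitive ::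
    "('g, 'm) monoid_scheme \<Rightarrow> ('g \<Rightarrow> 'v \<Rightarrow> 'v) \<Rightarrow> 'v pair_pre_digraph \<Rightarrow> bool" where
  "vertex_biprimitive G \<phi> \<Gamma> \<longleftrightarrow> biprimitive_action G (pverts \<Gamma>) \<phi>"

definition locally_imprimitive ::
    "('g, 'm) monoid_scheme \<Rightarrow> ('g \<Rightarrow> 'v \<Rightarrow> 'v) \<Rightarrow> 'v pair_pre_digraph \<Rightarrow> bool" where
  "locally_imprimitive G \<phi> \<Gamma> \<longleftrightarrow>
     (\<forall>v\<in>pverts \<Gamma>. imprimitive_action (G\<lparr>carrier := stabilizer G \<phi> v\<rparr>)
                      (nbrs \<Gamma> v) (local_action \<phi> \<Gamma> v))"


subsection \<open>Quotient graphs and spreads\<close>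

text \<open>The condition \<^term>\<open>B \<noteq> C\<close> makes the quotient simple.\<close>

definition quotient_graph :: "'v pair_pre_digraph \<Rightarrow> 'v set set \<Rightarrow> 'v set pair_pre_digraph" where
  "quotient_graph \<Gamma> P =
     \<lparr>pverts = P,
      parcs = {(B, C). B \<in> P \<and> C \<in> P \<and> B \<noteq> C \<and> (\<exists>v\<in>B. \<exists>w\<in>C. (v, w) \<in> parcs \<Gamma>)}\<rparr>"

definition spread_of_quotient :: "'v pair_pre_digraph \<Rightarrow> 'v set set \<Rightarrow> bool" where
  "spread_of_quotient \<Gamma> P \<longleftrightarrow>
     (\<forall>(B, C)\<in>parcs (quotient_graph \<Gamma> P).
        \<exists>!a. a \<in> parcs \<Gamma> \<and> fst a \<in> B \<and> snd a \<in> C)"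

definition equivariant_graph_iso ::
    "('g, 'm) monoid_scheme \<Rightarrow> ('g \<Rightarrow> 'v \<Rightarrow> 'v) \<Rightarrow> 'v pair_pre_digraph
      \<Rightarrow> ('g \<Rightarrow> 'w \<Rightarrow> 'w) \<Rightarrow> 'w pair_pre_digraph \<Rightarrow> ('v \<Rightarrow> 'w) \<Rightarrow> bool" where
  "equivariant_graph_iso G \<phi> \<Gamma> \<psi> \<Delta> f \<longleftrightarrow>
     bij_betw f (pverts \<Gamma>) (pverts \<Delta>) \<and>
     (\<forall>u\<in>pverts \<Gamma>. \<forall>v\<in>pverts \<Gamma>. (f u, f v) \<in> parcs \<Delta> \<longleftrightarrow> (u, v) \<in> parcs \<Gamma>) \<and>
     (\<forall>g\<in>carrier G. \<forall>v\<in>pverts \<Gamma>. f (\<phi> g v) = \<psi> g (f v))"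

end

theory Submission
  imports Defs
begin

text \<open>
  A map on the edges whose kernel is invariant under an edge-primitive group is constant or injective.
  Everything follows by choosing suitable maps.

  If \<open>G\<close> is not arc-transitive, its orbits orient the edges. Apply the dichotomy to the maps
  sending an oriented edge to its tail and to its head: a constant map gives a star, while two injective
  maps give a cycle on which \<open>G\<close> acts by rotations, so that the length is prime.

  For an invariant vertex partition with at least three parts, apply it to the map from edges to edges
  of the quotient. It is injective, so the graph is a spread of the quotient, and the stabiliser of a
  part \<open>B\<close> preserves the partition of the neighbours of \<open>B\<close> according to the endpoint in \<open>B\<close>.

  Conversely, the blocks of a vertex stabiliser on its neighbourhood are transported by \<open>G\<close> to all
  vertices. Splitting each vertex into its blocks leaves the action on edges unchanged, and the
  dichotomy for the map from edges to connected components shows that the result is connected.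
\<close>

section \<open>Primitive actions and equivariant maps\<close>

text \<open>Ends of oriented edges, residues along a cycle, edges of a quotient and components all
  arise as values of explicit maps, so that only the invariance of a kernel has to be checked.
  Connectedness turns a constant map into a global statement: if all edges join the same two parts,
  then, no vertex being isolated, there are only two parts, and this is where the biprimitive case
  splits off. In the converse the obstacle is consistency: block systems chosen independently at the
  vertices would not be permuted by \<open>G\<close>. Transporting a single one works since two
  elements with the same effect on the base vertex differ by an element of its stabiliser.
  Arc-transitivity, which lets the transport reach every arc, is available because local
  imprimitivity forces valency at least three and so excludes stars and cycles. A split vertex keeps
  at least two edges because blocks are not singletons, which the component argument needs; the
  vertex set grows because blocks are proper.\<close>

lemma group_actionI:
  assumes "group G"
    and ext: "\<And>g. g \<in> carrier G \<Longrightarrow> \<phi> g \<in> extensional \<Omega>"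
    and closed: "\<And>g x. g \<in> carrier G \<Longrightarrow> x \<in> \<Omega> \<Longrightarrow> \<phi> g x \<in> \<Omega>"
    and one: "\<And>x. x \<in> \<Omega> \<Longrightarrow> \<phi> \<one>\<^bsub>G\<^esub> x = x"
    and mult: "\<And>g h x. g \<in> carrier G \<Longrightarrow> h \<in> carrier G \<Longrightarrow> x \<in> \<Omega>
      \<Longrightarrow> \<phi> (g \<otimes>\<^bsub>G\<^esub> h) x = \<phi> g (\<phi> h x)"
  shows "group_action G \<Omega> \<phi>"
proof -
  interpret group G by fact
  have inv: "\<phi> (inv\<^bsub>G\<^esub> g) (\<phi> g x) = x" "\<phi> g (\<phi> (inv\<^bsub>G\<^esub> g) x) = x"
    if "g \<in> carrier G" "x \<in> \<Omega>" for g x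
    using that mult[of "inv\<^bsub>G\<^esub> g" g x] mult[of g "inv\<^bsub>G\<^esub> g" x] one by auto
  have bij: "\<phi> g \<in> Bij \<Omega>" if g: "g \<in> carrier G" for g
  proof -
    have "bij_betw (\<phi> g) \<Omega> \<Omega>"
      by (rule bij_betwI[where g = "\<phi> (inv\<^bsub>G\<^esub> g)"]) (use g closed inv in auto)
    then show ?thesis using ext[OF g] by (simp add: Bij_def)
  qed
  have "\<phi> (g \<otimes>\<^bsub>G\<^esub> h) = \<phi> g \<otimes>\<^bsub>BijGroup \<Omega>\<^esub> \<phi> h"
    if g: "g \<in> carrier G" and h: "h \<in> carrier G" for g h
  proof -
    have "\<phi> (g \<otimes>\<^bsub>G\<^esub> h) = compose \<Omega> (\<phi> g) (\<phi> h)"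
      by (rule extensionalityI[OF ext[OF m_closed[OF g h]]])
        (use g h mult in \<open>auto simp: compose_def\<close>)
    then show ?thesis using bij g h by (simp add: BijGroup_def)
  qed
  then have "\<phi> \<in> hom G (BijGroup \<Omega>)"
    using bij by (intro homI) (auto simp: BijGroup_def)
  then show ?thesis
    by (simp add: group_action_def group_hom_def group_hom_axioms_def group_BijGroup \<open>group G\<close>)
qed

context group_action
begin

lemma group_G: "group G"
  using group_hom by (simp add: group_hom_def)

lemma act_closed: "g \<in> carrier G \<Longrightarrow> x \<in> E \<Longrightarrow> \<phi> g x \<in> E"
  using element_image by blast

lemma act_one: "x \<in> E \<Longrightarrow> \<phi> \<one> x = x"
  using id_eq_one by (metis restrict_apply')

lemma act_inv:
  assumes "g \<in> carrier G" "x \<in> E"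
  shows "\<phi> (inv g) (\<phi> g x) = x" "\<phi> g (\<phi> (inv g) x) = x"
proof -
  interpret group G by (rule group_G)
  show "\<phi> (inv g) (\<phi> g x) = x" using orbit_sym_aux[OF assms] by simp
  show "\<phi> g (\<phi> (inv g) x) = x" using orbit_sym_aux[OF inv_closed[OF assms(1)] assms(2)] assms by simp
qed

end

section \<open>Fibre systems of maps and the dichotomy for primitive actions\<close>

definition fibres :: "'a set \<Rightarrow> ('a \<Rightarrow> 'b) \<Rightarrow> 'a set set" where
  "fibres \<Omega> \<pi> = (\<lambda>x. {y \<in> \<Omega>. \<pi> y = \<pi> x}) ` \<Omega>"

text \<open>No action on the codomain is required, so \<open>\<pi>\<close> may take values in
  residues or in sets of vertices. One implication is enough: applied to the inverse group element
  it yields the other.\<close>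

definition kernel_invariant ::
    "('g, 'm) monoid_scheme \<Rightarrow> 'a set \<Rightarrow> ('g \<Rightarrow> 'a \<Rightarrow> 'a) \<Rightarrow> ('a \<Rightarrow> 'b) \<Rightarrow> bool" where
  "kernel_invariant G \<Omega> \<phi> \<pi> \<longleftrightarrow>
     (\<forall>g\<in>carrier G. \<forall>x\<in>\<Omega>. \<forall>y\<in>\<Omega>. \<pi> x = \<pi> y \<longrightarrow> \<pi> (\<phi> g x) = \<pi> (\<phi> g y))"

lemma fibre_in_fibres: "x \<in> \<Omega> \<Longrightarrow> {y \<in> \<Omega>. \<pi> y = \<pi> x} \<in> fibres \<Omega> \<pi>"
  unfolding fibres_def by (rule imageI)

lemma partition_on_fibres: "partition_on \<Omega> (fibres \<Omega> \<pi>)"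
  by (rule partition_onI) (auto simp: fibres_def disjnt_def)

lemma (in group_action) invariant_partition_fibres:
  assumes "kernel_invariant G E \<phi> \<pi>"
  shows "invariant_partition G E \<phi> (fibres E \<pi>)"
  unfolding invariant_partition_def
proof (intro conjI ballI partition_on_fibres)
  interpret group G by (rule group_G)
  fix g B assume g: "g \<in> carrier G" and "B \<in> fibres E \<pi>"
  then obtain x where x: "x \<in> E" and B: "B = {y \<in> E. \<pi> y = \<pi> x}" by (auto simp: fibres_def)
  have ker: "\<pi> (\<phi> h y) = \<pi> (\<phi> h z)" if "h \<in> carrier G" "y \<in> E" "z \<in> E" "\<pi> y = \<pi> z" for h y z
    using assms that unfolding kernel_invariant_def by blast
  have "\<phi> g ` B = {y \<in> E. \<pi> y = \<pi> (\<phi> g x)}"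
  proof (intro equalityI subsetI)
    fix y assume "y \<in> \<phi> g ` B"
    then show "y \<in> {y \<in> E. \<pi> y = \<pi> (\<phi> g x)}" using B g x by (auto intro: act_closed ker)
  next
    fix y assume "y \<in> {y \<in> E. \<pi> y = \<pi> (\<phi> g x)}"
    then have y: "y \<in> E" "\<pi> y = \<pi> (\<phi> g x)" by auto
    have "\<pi> (\<phi> (inv g) y) = \<pi> x"
      using ker[of "inv g" y "\<phi> g x"] act_inv(1)[OF g x] act_closed[OF g x] g y by simp
    then have "\<phi> (inv g) y \<in> B" using B y g by (auto intro: act_closed)
    then show "y \<in> \<phi> g ` B" using act_inv(2)[OF g y(1)] by (metis imageI)
  qed
  then show "\<phi> g ` B \<in> fibres E \<pi>" using fibre_in_fibres[OF act_closed[OF g x], of \<pi>] by simp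
qed

lemma (in group_action) nontrivial_system_fibres:
  assumes "kernel_invariant G E \<phi> \<pi>" "\<nexists>c. \<forall>x\<in>E. \<pi> x = c" "\<not> inj_on \<pi> E"
  shows "nontrivial_system G E \<phi> (fibres E \<pi>)"
proof -
  have "fibres E \<pi> \<noteq> {E}"
  proof
    assume eq: "fibres E \<pi> = {E}"
    have "{y \<in> E. \<pi> y = \<pi> x} = E" if "x \<in> E" for x
      using fibre_in_fibres[OF that, of \<pi>] eq by simp
    then have "\<And>x y. x \<in> E \<Longrightarrow> y \<in> E \<Longrightarrow> \<pi> y = \<pi> x" by blast
    then show False using assms(2) by blast
  qed
  moreover have "fibres E \<pi> \<noteq> (\<lambda>x. {x}) ` E"
  proof
    assume eq: "fibres E \<pi> = (\<lambda>x. {x}) ` E"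
    have "x = y" if "x \<in> E" "y \<in> E" "\<pi> x = \<pi> y" for x y
    proof -
      have "{z \<in> E. \<pi> z = \<pi> x} \<in> (\<lambda>x. {x}) ` E"
        using fibre_in_fibres[OF that(1), of \<pi>] eq by simp
      then obtain z where z: "{z \<in> E. \<pi> z = \<pi> x} = {z}" by auto
      have "x \<in> {z}" "y \<in> {z}" unfolding z[symmetric] using that by auto
      then show ?thesis by simp
    qed
    then show False using assms(3) by (auto simp: inj_on_def)
  qed
  ultimately show ?thesis
    using invariant_partition_fibres[OF assms(1)] by (simp add: nontrivial_system_def)
qed

lemma primitive_action_imp_group_action: "primitive_action G \<Omega> \<phi> \<Longrightarrow> group_action G \<Omega> \<phi>"
  by (simp add: primitive_action_def transitive_action_def)

text \<open>The two trivial partitions are the fibre systems of constant and of injective maps; any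
  other map with invariant kernel would have a nontrivial system as its fibres.\<close>

lemma primitive_action_constant_or_inj:
  assumes "primitive_action G \<Omega> \<phi>" "kernel_invariant G \<Omega> \<phi> \<pi>"
  shows "(\<exists>c. \<forall>x\<in>\<Omega>. \<pi> x = c) \<or> inj_on \<pi> \<Omega>"
proof -
  interpret group_action G \<Omega> \<phi> using assms(1) by (rule primitive_action_imp_group_action)
  show ?thesis using nontrivial_system_fibres[OF assms(2)] assms(1)
    by (auto simp: primitive_action_def)
qed

text \<open>For a partition this is a union of a single set, hence the projection onto the parts,
  defined without a choice operator; points outside the partitioned set go to the empty set.\<close>

definition part_of :: "'a set set \<Rightarrow> 'a \<Rightarrow> 'a set" where
  "part_of P x = \<Union>{B \<in> P. x \<in> B}"

lemma part_of_eq: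
  assumes "partition_on \<Omega> P" "B \<in> P" "x \<in> B"
  shows "part_of P x = B"
proof -
  have "C = B" if "C \<in> P" "x \<in> C" for C
    using assms that partition_onD2[OF assms(1)] by (auto simp: disjoint_def)
  then have "{B \<in> P. x \<in> B} = {B}" using assms by blast
  then show ?thesis by (simp add: part_of_def)
qed

lemma part_of_in:
  assumes "partition_on \<Omega> P" "x \<in> \<Omega>"
  shows "part_of P x \<in> P" "x \<in> part_of P x"
proof -
  obtain B where "B \<in> P" "x \<in> B" using assms by (auto simp: partition_on_def)
  then show "part_of P x \<in> P" "x \<in> part_of P x" using part_of_eq[OF assms(1)] by auto
qed

lemma part_of_eq_iff:
  assumes "partition_on \<Omega> P" "x \<in> \<Omega>" "y \<in> \<Omega>"
  shows "part_of P x = part_of P y \<longleftrightarrow> x \<in> part_of P y"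
proof
  assume "x \<in> part_of P y"
  then show "part_of P x = part_of P y" using part_of_eq[OF assms(1)] part_of_in(1)[OF assms(1,3)] by blast
next
  assume "part_of P x = part_of P y"
  then show "x \<in> part_of P y" using part_of_in(2)[OF assms(1,2)] by simp
qed

lemma part_of_act:
  assumes "invariant_partition G \<Omega> \<phi> P" "g \<in> carrier G" "x \<in> \<Omega>"
  shows "part_of P (\<phi> g x) = \<phi> g ` part_of P x"
proof -
  have P: "partition_on \<Omega> P" using assms(1) by (simp add: invariant_partition_def)
  note in_P = part_of_in[OF P assms(3)]
  show ?thesis
    by (rule part_of_eq[OF P]) (use assms in_P in \<open>auto simp: invariant_partition_def\<close>)
qed

lemma kernel_invariant_part_of:
  "invariant_partition G \<Omega> \<phi> P \<Longrightarrow> kernel_invariant G \<Omega> \<phi> (part_of P)"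
  by (simp add: kernel_invariant_def part_of_act)

lemma part_of_constant_onD:
  assumes "partition_on \<Omega> P" "\<exists>c. \<forall>x\<in>\<Omega>. part_of P x = c" "\<Omega> \<noteq> {}"
  shows "P = {\<Omega>}"
proof -
  obtain C where C: "\<forall>x\<in>\<Omega>. part_of P x = C" using assms(2) by blast
  have "B = C" if "B \<in> P" for B
  proof -
    obtain x where "x \<in> B" using partition_onD3[OF assms(1)] \<open>B \<in> P\<close> by (metis ex_in_conv)
    moreover then have "x \<in> \<Omega>" using that assms(1) by (auto simp: partition_on_def)
    ultimately show ?thesis using part_of_eq[OF assms(1) that] C by auto
  qed
  moreover have "P \<noteq> {}" using assms(1,3) by (auto simp: partition_on_def)
  ultimately have "P = {C}" by auto
  then show ?thesis using assms(1) by (simp add: partition_on_def)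
qed

lemma part_of_inj_onD:
  assumes "partition_on \<Omega> P" "inj_on (part_of P) \<Omega>"
  shows "P = (\<lambda>x. {x}) ` \<Omega>"
proof -
  have single: "part_of P x = {x}" if "x \<in> \<Omega>" for x
  proof -
    have "y = x" if y: "y \<in> part_of P x" for y
    proof -
      have "y \<in> \<Omega>" using part_of_in[OF assms(1) \<open>x \<in> \<Omega>\<close>] y assms(1) by (auto simp: partition_on_def)
      then show ?thesis
        using part_of_eq_iff[OF assms(1)] y \<open>x \<in> \<Omega>\<close> assms(2) by (auto simp: inj_on_def)
    qed
    then show ?thesis using part_of_in[OF assms(1) that] by auto
  qed
  have "P = part_of P ` \<Omega>"
  proof (intro equalityI subsetI)
    fix B assume B: "B \<in> P"
    then obtain x where "x \<in> B" using partition_onD3[OF assms(1)] by (metis ex_in_conv)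
    then show "B \<in> part_of P ` \<Omega>"
      using part_of_eq[OF assms(1) B] B assms(1) by (auto simp: partition_on_def)
  qed (use part_of_in[OF assms(1)] in auto)
  then show ?thesis using single by auto
qed

text \<open>A block system on \<open>\<Omega>'\<close> pulls back to the kernel of
  \<open>part_of P\<close> after \<open>f\<close>, to which the dichotomy on \<open>\<Omega>\<close>
  applies. This moves primitivity between edges, oriented edges, quotient edges and edges of the
  split graph.\<close>

lemma primitive_action_bij:
  assumes prim: "primitive_action G \<Omega> \<phi>" and act: "group_action G \<Omega>' \<psi>"
    and bij: "bij_betw f \<Omega> \<Omega>'"
    and equi: "\<And>g x. g \<in> carrier G \<Longrightarrow> x \<in> \<Omega> \<Longrightarrow> f (\<phi> g x) = \<psi> g (f x)"
  shows "primitive_action G \<Omega>' \<psi>"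
proof -
  interpret trans: transitive_action G \<Omega> \<phi> using prim by (simp add: primitive_action_def)
  interpret act: group_action G \<Omega>' \<psi> by fact
  have ne: "\<Omega>' \<noteq> {}" "f ` \<Omega> = \<Omega>'" "\<Omega> \<noteq> {}"
    using prim bij by (auto simp: primitive_action_def bij_betw_def)
  have "transitive_action G \<Omega>' \<psi>"
  proof unfold_locales
    fix x y assume "x \<in> \<Omega>'" "y \<in> \<Omega>'"
    then obtain x' y' where "x' \<in> \<Omega>" "x = f x'" "y' \<in> \<Omega>" "y = f y'" using ne by auto
    moreover then obtain g where "g \<in> carrier G" "\<phi> g x' = y'" using trans.unique_orbit by blast
    ultimately show "\<exists>g\<in>carrier G. \<psi> g x = y" using equi by metis
  qed
  moreover have "\<not> nontrivial_system G \<Omega>' \<psi> P" for P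
  proof
    assume P: "nontrivial_system G \<Omega>' \<psi> P"
    then have inv: "invariant_partition G \<Omega>' \<psi> P" by (simp add: nontrivial_system_def)
    then have part: "partition_on \<Omega>' P" by (simp add: invariant_partition_def)
    let ?\<pi> = "\<lambda>x. part_of P (f x)"
    have "kernel_invariant G \<Omega> \<phi> ?\<pi>"
      using kernel_invariant_part_of[OF inv] ne(2) by (auto simp: kernel_invariant_def equi)
    then have "(\<exists>c. \<forall>x\<in>\<Omega>. ?\<pi> x = c) \<or> inj_on ?\<pi> \<Omega>"
      by (rule primitive_action_constant_or_inj[OF prim])
    then show False
    proof
      assume "\<exists>c. \<forall>x\<in>\<Omega>. ?\<pi> x = c"
      then have "\<exists>c. \<forall>x\<in>\<Omega>'. part_of P x = c" using ne(2) by auto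
      then show False using part_of_constant_onD[OF part] ne P by (auto simp: nontrivial_system_def)
    next
      assume "inj_on ?\<pi> \<Omega>"
      then have "inj_on (part_of P) \<Omega>'" using ne(2) by (auto simp: inj_on_def)
      then show False using part_of_inj_onD[OF part] P by (auto simp: nontrivial_system_def)
    qed
  qed
  ultimately show ?thesis using ne by (auto simp: primitive_action_def)
qed

section \<open>Groups acting on graphs\<close>

lemma AutGroup_group_hom:
  "\<phi> \<in> hom G (AutGroup \<Gamma>) \<Longrightarrow> \<phi> \<in> hom G (BijGroup (pverts \<Gamma>))"
  by (auto simp: hom_def AutGroup_def BijGroup_def)

text \<open>Connectedness as an induction principle along arcs: symmetry of the arc set upgrades
  weak connectedness to directed reachability, along which membership in \<open>S\<close>
  propagates.\<close>

lemma connected_closed: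
  assumes "connected (with_proj \<Gamma>)" "pair_graph \<Gamma>" "u \<in> pverts \<Gamma>" "u \<in> S"
    and closed: "\<And>x y. x \<in> S \<Longrightarrow> (x, y) \<in> parcs \<Gamma> \<Longrightarrow> y \<in> S"
  shows "pverts \<Gamma> \<subseteq> S"
proof
  fix v assume v: "v \<in> pverts \<Gamma>"
  interpret pair_graph \<Gamma> by fact
  have "strongly_connected (with_proj \<Gamma>)"
    using symmetric_connected_imp_strongly_connected[OF pair_sym_arcs assms(1)] .
  then have "u \<rightarrow>\<^sup>*\<^bsub>with_proj \<Gamma>\<^esub> v" using assms(3) v by (auto simp: strongly_connected_def)
  then show "v \<in> S"
    by (induction rule: reachable_induct) (use assms(4) closed in auto)
qed

text \<open>The action is a homomorphism into the automorphism group of an arbitrary graph, so that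
  one group can be made to act, by sublocales, on a graph, on its quotient and on the split
  graph.\<close>

locale graph_action = group G for G (structure) +
  fixes \<Gamma> :: "'v pair_pre_digraph" and \<phi> :: "'a \<Rightarrow> 'v \<Rightarrow> 'v"
  assumes graph: "pair_graph \<Gamma>" and hom: "\<phi> \<in> hom G (AutGroup \<Gamma>)"
begin

lemma arc_sym: "(u, v) \<in> parcs \<Gamma> \<Longrightarrow> (v, u) \<in> parcs \<Gamma>"
proof -
  interpret pair_graph \<Gamma> by (rule graph)
  show "(u, v) \<in> parcs \<Gamma> \<Longrightarrow> (v, u) \<in> parcs \<Gamma>"
    using pair_sym_arcs by (auto simp: symmetric_def sym_def)
qed

lemma arc_neq: "(u, v) \<in> parcs \<Gamma> \<Longrightarrow> u \<noteq> v"
  using graph by (metis pair_graph.axioms(1) pair_digraph.axioms(2) pair_loopfree_digraph.no_loops')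

lemma arc_verts: "(u, v) \<in> parcs \<Gamma> \<Longrightarrow> u \<in> pverts \<Gamma>" "(u, v) \<in> parcs \<Gamma> \<Longrightarrow> v \<in> pverts \<Gamma>"
proof -
  interpret pair_graph \<Gamma> by (rule graph)
  show "(u, v) \<in> parcs \<Gamma> \<Longrightarrow> u \<in> pverts \<Gamma>" "(u, v) \<in> parcs \<Gamma> \<Longrightarrow> v \<in> pverts \<Gamma>"
    using in_arcsD1 in_arcsD2 by auto
qed

lemma finite_pverts: "finite (pverts \<Gamma>)"
proof -
  interpret pair_graph \<Gamma> by (rule graph)
  show ?thesis by (rule pair_finite_verts)
qed

lemma vertex_group_action: "group_action G (pverts \<Gamma>) \<phi>"
  using AutGroup_group_hom[OF hom]
  by (simp add: group_action_def group_hom_def group_hom_axioms_def group_BijGroup is_group)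

sublocale V: group_action G "pverts \<Gamma>" \<phi>
  by (rule vertex_group_action)

lemma act_arc:
  assumes "g \<in> carrier G" "(u, v) \<in> parcs \<Gamma>"
  shows "(\<phi> g u, \<phi> g v) \<in> parcs \<Gamma>"
proof -
  have "\<phi> g \<in> carrier (AutGroup \<Gamma>)" using hom assms(1) by (auto simp: hom_def)
  then show ?thesis using assms(2) arc_verts[OF assms(2)] by (simp add: AutGroup_def)
qed

lemma edge_in_edge_set: "(u, v) \<in> parcs \<Gamma> \<Longrightarrow> {u, v} \<in> edge_set \<Gamma>"
  by (auto simp: edge_set_def)

lemma edge_setE:
  assumes "e \<in> edge_set \<Gamma>"
  obtains u v where "(u, v) \<in> parcs \<Gamma>" "e = {u, v}"
  using assms by (auto simp: edge_set_def)

lemma edge_action_edge: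
  "(u, v) \<in> parcs \<Gamma> \<Longrightarrow> edge_action \<phi> \<Gamma> g {u, v} = {\<phi> g u, \<phi> g v}"
  by (simp add: edge_action_def edge_in_edge_set)

lemma arc_action_arc:
  "(u, v) \<in> parcs \<Gamma> \<Longrightarrow> arc_action \<phi> \<Gamma> g (u, v) = (\<phi> g u, \<phi> g v)"
  by (simp add: arc_action_def)

sublocale edge: group_action G "edge_set \<Gamma>" "edge_action \<phi> \<Gamma>"
proof (rule group_actionI)
  show "edge_action \<phi> \<Gamma> \<one> e = e" if "e \<in> edge_set \<Gamma>" for e
    using that by (elim edge_setE) (simp add: edge_action_edge V.act_one arc_verts)
  show "edge_action \<phi> \<Gamma> g e \<in> edge_set \<Gamma>" if "g \<in> carrier G" "e \<in> edge_set \<Gamma>" for g e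
    using that(2,1) by (elim edge_setE) (simp add: edge_action_edge edge_in_edge_set act_arc)
  show "edge_action \<phi> \<Gamma> (g \<otimes> h) e = edge_action \<phi> \<Gamma> g (edge_action \<phi> \<Gamma> h e)"
    if "g \<in> carrier G" "h \<in> carrier G" "e \<in> edge_set \<Gamma>" for g h e
    using that(3,1,2)
    by (elim edge_setE) (simp add: edge_action_edge V.composition_rule arc_verts act_arc)
qed (auto simp: edge_action_def is_group)

sublocale arc: group_action G "parcs \<Gamma>" "arc_action \<phi> \<Gamma>"
  by (rule group_actionI)
    (use arc_verts act_arc in \<open>auto simp: arc_action_def is_group V.act_one V.composition_rule\<close>)

lemma arc_transitive_iff:
  "arc_transitive G \<phi> \<Gamma> \<longleftrightarrow>
     (\<forall>u v x y. (u, v) \<in> parcs \<Gamma> \<longrightarrow> (x, y) \<in> parcs \<Gamma> \<longrightarrow>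
        (\<exists>g\<in>carrier G. \<phi> g u = x \<and> \<phi> g v = y))"
  unfolding arc_transitive_def transitive_action_def transitive_action_axioms_def
  using arc.group_action_axioms by (auto simp: arc_action_arc)

lemma nbrs_subset: "nbrs \<Gamma> v \<subseteq> pverts \<Gamma>"
  using arc_verts by (auto simp: nbrs_def)

lemma stabilizer_act_nbrs:
  assumes "g \<in> stabilizer G \<phi> v" "w \<in> nbrs \<Gamma> v"
  shows "\<phi> g w \<in> nbrs \<Gamma> v"
  using assms act_arc[of g v w] by (simp add: stabilizer_def nbrs_def)

lemma local_group_action:
  assumes v: "v \<in> pverts \<Gamma>"
  shows "group_action (G\<lparr>carrier := stabilizer G \<phi> v\<rparr>) (nbrs \<Gamma> v) (local_action \<phi> \<Gamma> v)"
proof (rule group_actionI)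
  show "group (G\<lparr>carrier := stabilizer G \<phi> v\<rparr>)"
    using V.stabilizer_subgroup[OF v] subgroup.subgroup_is_group is_group by blast
qed (use stabilizer_act_nbrs nbrs_subset[of v] in
    \<open>auto simp: local_action_def V.act_one V.composition_rule stabilizer_def\<close>)

text \<open>An element carrying the arc \<open>(v, x)\<close> to the arc \<open>(v, y)\<close>
  automatically fixes \<open>v\<close>.\<close>

lemma transitive_local_action:
  assumes "arc_transitive G \<phi> \<Gamma>" "v \<in> pverts \<Gamma>"
  shows "transitive_action (G\<lparr>carrier := stabilizer G \<phi> v\<rparr>) (nbrs \<Gamma> v) (local_action \<phi> \<Gamma> v)"
proof -
  interpret local: group_action "G\<lparr>carrier := stabilizer G \<phi> v\<rparr>" "nbrs \<Gamma> v" "local_action \<phi> \<Gamma> v"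
    by (rule local_group_action[OF assms(2)])
  show ?thesis
  proof unfold_locales
    fix x y assume xy: "x \<in> nbrs \<Gamma> v" "y \<in> nbrs \<Gamma> v"
    then obtain g where "g \<in> carrier G" "\<phi> g v = v" "\<phi> g x = y"
      using assms(1) unfolding arc_transitive_iff nbrs_def by blast
    then show "\<exists>g\<in>carrier (G\<lparr>carrier := stabilizer G \<phi> v\<rparr>). local_action \<phi> \<Gamma> v g x = y"
      using xy by (auto simp: local_action_def stabilizer_def)
  qed
qed

text \<open>An unordered edge fixes the image of an arc only up to reversal; this ambiguity is the
  whole gap between edge- and arc-transitivity.\<close>

lemma edge_transitiveD:
  assumes "edge_primitive G \<phi> \<Gamma>" "(u, v) \<in> parcs \<Gamma>" "(x, y) \<in> parcs \<Gamma>"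
  obtains g where "g \<in> carrier G" "\<phi> g u = x \<and> \<phi> g v = y \<or> \<phi> g u = y \<and> \<phi> g v = x"
proof -
  interpret transitive_action G "edge_set \<Gamma>" "edge_action \<phi> \<Gamma>"
    using assms(1) by (simp add: edge_primitive_def primitive_action_def)
  obtain g where "g \<in> carrier G" "edge_action \<phi> \<Gamma> g {u, v} = {x, y}"
    using unique_orbit edge_in_edge_set assms(2,3) by metis
  then show ?thesis using that assms(2) by (auto simp: edge_action_edge doubleton_eq_iff)
qed

lemma edge_primitive_ex_arc: "edge_primitive G \<phi> \<Gamma> \<Longrightarrow> \<exists>u v. (u, v) \<in> parcs \<Gamma>"
  by (auto simp: edge_primitive_def primitive_action_def edge_set_def)

lemma connected_no_isolated:
  assumes "connected (with_proj \<Gamma>)" "(a, b) \<in> parcs \<Gamma>" "v \<in> pverts \<Gamma>"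
  obtains w where "(v, w) \<in> parcs \<Gamma>"
proof -
  have "pverts \<Gamma> \<subseteq> {v. \<exists>w. (v, w) \<in> parcs \<Gamma>}"
    by (rule connected_closed[OF assms(1) graph, of a]) (use assms(2) in \<open>blast intro: arc_verts arc_sym\<close>)+
  then show ?thesis using that assms(3) by auto
qed

lemma arc_transitive_imp_vertex_transitive:
  assumes "arc_transitive G \<phi> \<Gamma>" "\<And>v. v \<in> pverts \<Gamma> \<Longrightarrow> \<exists>w. (v, w) \<in> parcs \<Gamma>"
  shows "transitive_action G (pverts \<Gamma>) \<phi>"
proof unfold_locales
  fix x y assume "x \<in> pverts \<Gamma>" "y \<in> pverts \<Gamma>"
  then obtain x' y' where "(x, x') \<in> parcs \<Gamma>" "(y, y') \<in> parcs \<Gamma>" using assms(2) by blast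
  then show "\<exists>g\<in>carrier G. \<phi> g x = y" using assms(1) unfolding arc_transitive_iff by blast
qed

end

text \<open>The inverse group element preserves arcs as well, which turns the implication
  \<open>arc\<close> into the equivalence demanded by \<open>AutGroup\<close>.\<close>

lemma hom_AutGroupI:
  assumes "group_action G (pverts \<Gamma>) \<phi>"
    and arc: "\<And>g u v. g \<in> carrier G \<Longrightarrow> (u, v) \<in> parcs \<Gamma> \<Longrightarrow> (\<phi> g u, \<phi> g v) \<in> parcs \<Gamma>"
  shows "\<phi> \<in> hom G (AutGroup \<Gamma>)"
proof -
  interpret group_action G "pverts \<Gamma>" \<phi> by fact
  interpret group G by (rule group_G)
  have "(\<phi> g u, \<phi> g v) \<in> parcs \<Gamma> \<longleftrightarrow> (u, v) \<in> parcs \<Gamma>"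
    if "g \<in> carrier G" "u \<in> pverts \<Gamma>" "v \<in> pverts \<Gamma>" for g u v
    using arc[of g u v] arc[of "inv\<^bsub>G\<^esub> g" "\<phi> g u" "\<phi> g v"] act_inv(1)[of g] that by auto
  then have "\<phi> g \<in> carrier (AutGroup \<Gamma>)" if "g \<in> carrier G" for g
    using bij_prop0[OF that] that by (simp add: AutGroup_def)
  moreover have "\<phi> \<in> hom G (BijGroup (pverts \<Gamma>))"
    using group_hom by (simp add: group_hom_def group_hom_axioms_def)
  ultimately show ?thesis by (auto simp: hom_def AutGroup_def)
qed

lemma group_AutGroup: "group (AutGroup \<Gamma>)"
proof -
  interpret B: group "BijGroup (pverts \<Gamma>)" by (rule group_BijGroup)
  let ?A = "{g \<in> Bij (pverts \<Gamma>). \<forall>u\<in>pverts \<Gamma>. \<forall>v\<in>pverts \<Gamma>. (g u, g v) \<in> parcs \<Gamma> \<longleftrightarrow> (u, v) \<in> parcs \<Gamma>}"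
  have "subgroup ?A (BijGroup (pverts \<Gamma>))"
  proof (rule B.subgroupI)
    show "?A \<subseteq> carrier (BijGroup (pverts \<Gamma>))" by (auto simp: BijGroup_def)
    have "(\<lambda>x\<in>pverts \<Gamma>. x) \<in> ?A" by (auto simp: id_Bij)
    then show "?A \<noteq> {}" by blast
  next
    fix g assume g: "g \<in> ?A"
    then have bij: "bij_betw g (pverts \<Gamma>) (pverts \<Gamma>)" by (simp add: Bij_def)
    let ?i = "\<lambda>x\<in>pverts \<Gamma>. inv_into (pverts \<Gamma>) g x"
    have eq: "inv\<^bsub>BijGroup (pverts \<Gamma>)\<^esub> g = ?i" using g by (simp add: inv_BijGroup)
    have "(?i u, ?i v) \<in> parcs \<Gamma> \<longleftrightarrow> (u, v) \<in> parcs \<Gamma>" if uv: "u \<in> pverts \<Gamma>" "v \<in> pverts \<Gamma>" for u v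
    proof -
      have "g (?i u) = u" "g (?i v) = v" "?i u \<in> pverts \<Gamma>" "?i v \<in> pverts \<Gamma>"
        using uv bij_betw_inv_into_right[OF bij] bij_betwE[OF bij_betw_inv_into[OF bij]] by simp_all
      moreover have "(g x, g y) \<in> parcs \<Gamma> \<longleftrightarrow> (x, y) \<in> parcs \<Gamma>"
        if "x \<in> pverts \<Gamma>" "y \<in> pverts \<Gamma>" for x y
        using g that by simp
      ultimately show ?thesis by metis
    qed
    then show "inv\<^bsub>BijGroup (pverts \<Gamma>)\<^esub> g \<in> ?A"
      unfolding eq using g restrict_inv_into_Bij[of g "pverts \<Gamma>"] by blast
  next
    fix g h assume gh: "g \<in> ?A" "h \<in> ?A"
    have "h x \<in> pverts \<Gamma>" if "x \<in> pverts \<Gamma>" for x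
      using gh(2) that Bij_imp_funcset[of h "pverts \<Gamma>"] by auto
    then show "g \<otimes>\<^bsub>BijGroup (pverts \<Gamma>)\<^esub> h \<in> ?A"
      using gh compose_Bij[of g "pverts \<Gamma>" h] by (simp add: BijGroup_def compose_def)
  qed
  then show ?thesis unfolding AutGroup_def
    by (rule subgroup.subgroup_is_group) (rule group_BijGroup)
qed

lemma graph_action_aut_subgroup:
  assumes "pair_graph \<Gamma>" "subgroup G (AutGroup \<Gamma>)"
  shows "graph_action (aut_subgroup \<Gamma> G) \<Gamma> (\<lambda>g. g)"
proof -
  have "group (aut_subgroup \<Gamma> G)"
    using subgroup.subgroup_is_group[OF assms(2) group_AutGroup] .
  moreover have "(\<lambda>g. g) \<in> hom (aut_subgroup \<Gamma> G) (AutGroup \<Gamma>)"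
    using subgroup.subset[OF assms(2)] by (auto simp: hom_def)
  ultimately show ?thesis
    using assms(1) by (simp add: graph_action_def graph_action_axioms_def)
qed

section \<open>Arc-transitivity\<close>

text \<open>Injectivity of \<open>h\<close> excludes an initial tail: a collision between two
  iterates, which finiteness forces, cancels down to a return to \<open>x\<close> itself.\<close>

lemma inj_on_funpow_cycle:
  assumes "finite V" "inj_on h V" "h ` V \<subseteq> V" "x \<in> V"
  obtains n where "0 < n" "inj_on (\<lambda>i. (h ^^ i) x) {0..<n}" "\<And>i. (h ^^ (i mod n)) x = (h ^^ i) x"
proof -
  have in_V: "(h ^^ i) y \<in> V" if "y \<in> V" for i y
    using that assms(3) by (induction i) auto
  have inj: "y = z" if "(h ^^ i) y = (h ^^ i) z" "y \<in> V" "z \<in> V" for i y z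
    using that
  proof (induction i)
    case (Suc i)
    then show ?case using in_V assms(2) by (auto simp: inj_on_def)
  qed simp
  have shift: "(h ^^ (j - i)) x = x" if "i < j" "(h ^^ i) x = (h ^^ j) x" for i j
  proof -
    have "(h ^^ i) x = (h ^^ i) ((h ^^ (j - i)) x)"
      using that by (metis funpow_add comp_apply le_add_diff_inverse less_imp_le)
    then show ?thesis using inj in_V assms(4) by metis
  qed
  have "\<not> inj (\<lambda>i. (h ^^ i) x)"
  proof
    assume "inj (\<lambda>i. (h ^^ i) x)"
    moreover have "range (\<lambda>i. (h ^^ i) x) \<subseteq> V" using in_V assms(4) by auto
    ultimately show False
      using assms(1) by (metis finite_imageD finite_subset infinite_UNIV_nat)
  qed
  then obtain i j where "i < j" "(h ^^ i) x = (h ^^ j) x" by (metis injI linorder_neqE_nat)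
  then have ex: "\<exists>n. 0 < n \<and> (h ^^ n) x = x" using shift by (metis zero_less_diff)
  \<comment> \<open>The least positive return time; a collision among the first \<open>n\<close>
    iterates would give a shorter one.\<close>
  define n where "n = (LEAST n. 0 < n \<and> (h ^^ n) x = x)"
  have n: "0 < n" "(h ^^ n) x = x" using LeastI_ex[OF ex] by (auto simp: n_def)
  have least: "(h ^^ m) x \<noteq> x" if "0 < m" "m < n" for m
    using not_less_Least[of m "\<lambda>n. 0 < n \<and> (h ^^ n) x = x"] that by (auto simp: n_def)
  have "i = j" if "(h ^^ i) x = (h ^^ j) x" "i < n" "j < n" for i j
    using shift[of i j] shift[of j i] least[of "j - i"] least[of "i - j"] that
    by (metis less_imp_diff_less linorder_neqE_nat zero_less_diff)
  then have "inj_on (\<lambda>i. (h ^^ i) x) {0..<n}" by (auto simp: inj_on_def)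
  then show ?thesis using that n funpow_mod_eq[OF n(2)] by blast
qed

section \<open>Stars, orientations and oriented cycles\<close>

context graph_action
begin

text \<open>An arc leaving a neighbour of \<open>c\<close> must return to \<open>c\<close>, so
  connectedness leaves no vertices beyond \<open>c\<close> and its neighbours.\<close>

lemma is_star_if_common_vertex:
  assumes "connected (with_proj \<Gamma>)" "(a, b) \<in> parcs \<Gamma>"
    and c: "\<And>x y. (x, y) \<in> parcs \<Gamma> \<Longrightarrow> x = c \<or> y = c"
  shows "is_star \<Gamma>"
proof -
  let ?N = "nbrs \<Gamma> c"
  have cV: "c \<in> pverts \<Gamma>" using c[OF assms(2)] arc_verts[OF assms(2)] by auto
  have "pverts \<Gamma> \<subseteq> {c} \<union> ?N"
    by (rule connected_closed[OF assms(1) graph cV]) (use c in \<open>auto simp: nbrs_def\<close>)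
  then have "pverts \<Gamma> = {c} \<union> ?N" using cV nbrs_subset by auto
  moreover have "{c} \<inter> ?N = {}" using arc_neq by (auto simp: nbrs_def)
  moreover have "parcs \<Gamma> = {c} \<times> ?N \<union> ?N \<times> {c}"
  proof (intro equalityI subsetI)
    fix a assume "a \<in> parcs \<Gamma>"
    then show "a \<in> {c} \<times> ?N \<union> ?N \<times> {c}"
      using c arc_sym by (cases a) (auto simp: nbrs_def)
  qed (use arc_sym in \<open>auto simp: nbrs_def\<close>)
  moreover have "card {c} = 1" by simp
  ultimately show ?thesis
    unfolding is_star_def complete_bipartite_digraph_pair_def using finite_pverts by blast
qed

text \<open>Antisymmetry makes the passage from an arc of \<open>A\<close> to its edge injective, so
  primitivity carries over. The gain is that an arc has a distinguished tail and head, whereas the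
  ends of an edge are interchangeable.\<close>

lemma primitive_on_orientation:
  assumes prim: "edge_primitive G \<phi> \<Gamma>" and A: "A \<union> A\<inverse> = parcs \<Gamma>"
    and antisym: "\<And>x y. (x, y) \<in> A \<Longrightarrow> (y, x) \<notin> A"
    and closed: "\<And>g x y. g \<in> carrier G \<Longrightarrow> (x, y) \<in> A \<Longrightarrow> (\<phi> g x, \<phi> g y) \<in> A"
  shows "primitive_action G A (\<lambda>g. \<lambda>a\<in>A. (\<phi> g (fst a), \<phi> g (snd a)))"
proof -
  let ?\<psi> = "\<lambda>g. \<lambda>a\<in>A. (\<phi> g (fst a), \<phi> g (snd a))"
  have sub: "(x, y) \<in> parcs \<Gamma>" if "(x, y) \<in> A" for x y using that A by blast
  interpret A: group_action G A ?\<psi>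
    by (rule group_actionI)
      (use closed in \<open>auto simp: is_group arc_verts[OF sub] V.act_one V.composition_rule\<close>)
  let ?h = "\<lambda>a. {fst a, snd a}"
  have "inj_on ?h A"
    using antisym by (auto simp: inj_on_def doubleton_eq_iff)
  moreover have "?h ` A = edge_set \<Gamma>"
  proof (intro equalityI subsetI)
    fix e assume "e \<in> edge_set \<Gamma>"
    then obtain u v where "(u, v) \<in> parcs \<Gamma>" "e = {u, v}" by (rule edge_setE)
    then have "(u, v) \<in> A \<or> (v, u) \<in> A" "e = {u, v}" using A by auto
    then show "e \<in> ?h ` A" by (force simp: insert_commute)
  qed (use sub in \<open>auto intro: edge_in_edge_set\<close>)
  ultimately have bij: "bij_betw ?h A (edge_set \<Gamma>)" by (simp add: bij_betw_def)
  show ?thesis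
  proof (rule primitive_action_bij)
    show "primitive_action G (edge_set \<Gamma>) (edge_action \<phi> \<Gamma>)"
      using prim by (simp add: edge_primitive_def)
    show "group_action G A ?\<psi>" by (rule A.group_action_axioms)
    show "bij_betw (inv_into A ?h) (edge_set \<Gamma>) A" by (rule bij_betw_inv_into[OF bij])
    fix g e assume g: "g \<in> carrier G" and e: "e \<in> edge_set \<Gamma>"
    then obtain a where a: "a \<in> A" "e = ?h a"
      using bij_betw_imp_surj_on[OF bij] by (metis (no_types, lifting) imageE)
    have "edge_action \<phi> \<Gamma> g e = ?h (?\<psi> g a)"
      using a edge_action_edge[OF sub[of "fst a" "snd a"]] by simp
    moreover have "inv_into A ?h (?h (?\<psi> g a)) = ?\<psi> g a"
      by (rule bij_betw_inv_into_left[OF bij A.act_closed[OF g a(1)]])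
    moreover have "inv_into A ?h e = a"
      unfolding a(2) by (rule bij_betw_inv_into_left[OF bij a(1)])
    ultimately show "inv_into A ?h (edge_action \<phi> \<Gamma> g e) = ?\<psi> g (inv_into A ?h e)"
      by (simp only:)
  qed
qed

text \<open>Injectivity of \<open>fst\<close> and \<open>snd\<close> gives every vertex at most one
  outgoing and one incoming arc of \<open>A\<close>. As \<open>h\<close> moves \<open>u\<close> to
  its successor, the iterates of \<open>h\<close> on \<open>u\<close> follow the arcs and close up
  to a cycle, which connectedness makes the whole graph.\<close>

lemma oriented_cycle_prime:
  assumes prim: "edge_primitive G \<phi> \<Gamma>" and conn: "connected (with_proj \<Gamma>)"
    and A: "A \<union> A\<inverse> = parcs \<Gamma>"
    and antisym: "\<And>x y. (x, y) \<in> A \<Longrightarrow> (y, x) \<notin> A"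
    and closed: "\<And>g x y. g \<in> carrier G \<Longrightarrow> (x, y) \<in> A \<Longrightarrow> (\<phi> g x, \<phi> g y) \<in> A"
    and fst: "inj_on fst A" and snd: "inj_on snd A"
    and h: "h \<in> carrier G" and path: "(u, v) \<in> A" "(v, w) \<in> A" and hu: "\<phi> h u = v"
  shows "\<exists>p::nat. prime p \<and> is_cycle_graph p \<Gamma>"
proof -
  have sub: "(x, y) \<in> parcs \<Gamma>" if "(x, y) \<in> A" for x y using that A by blast
  have uniq: "y = z" if "(x, y) \<in> A" "(x, z) \<in> A" for x y z
    using inj_onD[OF fst _ that] by simp
  have uniq': "y = z" if "(y, x) \<in> A" "(z, x) \<in> A" for x y z
    using inj_onD[OF snd _ that] by simp
  define f where "f = (\<lambda>i. (\<phi> h ^^ i) u)"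
  have f0: "f 0 = u" and f_Suc: "f (Suc i) = \<phi> h (f i)" for i by (simp_all add: f_def)
  have arc: "(f i, f (Suc i)) \<in> A" for i
  proof (induction i)
    case 0
    then show ?case using path(1) hu by (simp add: f_def)
  next
    case (Suc i)
    then show ?case using closed[OF h] f_Suc by metis
  qed
  have uV: "u \<in> pverts \<Gamma>" using arc_verts sub path(1) by blast
  obtain n where n: "0 < n" "inj_on f {0..<n}" and mod_n: "\<And>i. f (i mod n) = f i"
    using inj_on_funpow_cycle[OF finite_pverts V.inj_prop[OF h] _ uV] V.surj_prop[OF h]
    unfolding f_def by auto
  have "pverts \<Gamma> \<subseteq> range f"
  proof (rule connected_closed[OF conn graph uV])
    show "u \<in> range f" using f0 by (metis rangeI)
    fix x y assume "x \<in> range f" "(x, y) \<in> parcs \<Gamma>"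
    then obtain i where i: "x = f i" and "(x, y) \<in> A \<or> (y, x) \<in> A" using A by auto
    then show "y \<in> range f"
    proof (elim disjE)
      assume "(x, y) \<in> A"
      then show ?thesis using uniq[OF arc[of i]] i by auto
    next
      assume yx: "(y, x) \<in> A"
      \<comment> \<open>The predecessor of \<open>f i\<close> on the cycle; adding \<open>n\<close>
        keeps the subtraction on natural numbers from truncating at \<open>i = 0\<close>.\<close>
      have "f (Suc (i + n - 1)) = f i" using mod_n[of "i + n"] mod_n[of i] n(1) by simp
      then show ?thesis using uniq'[of y x "f (i + n - 1)"] arc[of "i + n - 1"] yx i by auto
    qed
  qed
  moreover have "f ` {0..<n} = range f"
    using mod_n n(1) by (auto simp: image_iff) (metis atLeast0LessThan lessThan_iff mod_less_divisor)
  moreover have "range f \<subseteq> pverts \<Gamma>" using arc sub arc_verts by blast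
  ultimately have bij: "bij_betw f {0..<n} (pverts \<Gamma>)" using n(2) by (auto simp: bij_betw_def)
  have eq_iff: "f i = f j \<longleftrightarrow> i mod n = j mod n" for i j
  proof
    assume "f i = f j"
    then have "f (i mod n) = f (j mod n)" by (simp add: mod_n)
    then show "i mod n = j mod n" using n by (auto simp: inj_on_def)
  qed (metis mod_n)
  have A_iff: "(f i, f j) \<in> A \<longleftrightarrow> f j = f (Suc i)" for i j
    using arc[of i] uniq by metis
  \<comment> \<open>Period 1 would make a loop, and period 2 would put both directions of one edge
    into \<open>A\<close>.\<close>
  have "n \<noteq> 1" using arc[of 0] arc_neq[OF sub] mod_n[of 1] by force
  moreover have "n \<noteq> 2"
  proof
    assume "n = 2"
    then have "(f 1, f 0) \<in> A" using arc[of 1] mod_n[of 2] by (simp add: numeral_2_eq_2)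
    then show False using arc[of 0] antisym by simp
  qed
  ultimately have n3: "3 \<le> n" using n(1) by linarith
  have arcs: "(f i, f j) \<in> parcs \<Gamma> \<longleftrightarrow> j = (i + 1) mod n \<or> i = (j + 1) mod n"
    if "i < n" "j < n" for i j
    using that unfolding A[symmetric] by (auto simp: A_iff eq_iff)
  have cyc: "is_cycle_graph n \<Gamma>"
    unfolding is_cycle_graph_def
  proof (intro conjI exI[of _ f] n3 bij equalityI subsetI)
    fix a assume a: "a \<in> parcs \<Gamma>"
    obtain x y where xy: "a = (x, y)" by (cases a)
    then obtain i j where "i < n" "j < n" "x = f i" "y = f j"
      using a arc_verts[of x y] bij unfolding bij_betw_def by (metis atLeastLessThan_iff imageE)
    then show "a \<in> {(f i, f j) |i j. i < n \<and> j < n \<and> (j = (i + 1) mod n \<or> i = (j + 1) mod n)}"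
      using a xy arcs by auto
  qed (use arcs in blast)
  \<comment> \<open>Outgoing arcs are unique and preserved by \<open>g\<close>, so \<open>g\<close>
    commutes with the successor step and is the rotation determined by the image of
    \<open>u\<close>.\<close>
  have shift: "\<exists>c. \<forall>i. \<phi> g (f i) = f (i + c)" if g: "g \<in> carrier G" for g
  proof -
    have "\<phi> g u \<in> range f"
      using V.act_closed[OF g uV] \<open>pverts \<Gamma> \<subseteq> range f\<close> by blast
    then obtain c where c: "\<phi> g (f 0) = f c" using f0 by auto
    have "\<phi> g (f i) = f (i + c)" for i
    proof (induction i)
      case (Suc i)
      have "(\<phi> g (f i), \<phi> g (f (Suc i))) \<in> A" using closed[OF g arc] .
      then show ?case using Suc uniq arc[of "i + c"] by auto
    qed (use c in simp)
    then show ?thesis by blast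
  qed
  have "prime n"
  proof (rule ccontr)
    assume "\<not> prime n"
    then obtain a where a: "a dvd n" "a \<noteq> 1" "a \<noteq> n" using n3 unfolding prime_nat_iff by auto
    define ix where "ix = (\<lambda>x. inv_into {0..<n} f x)"
    have ix: "ix (f i) = i mod n" for i
    proof -
      have "ix (f (i mod n)) = i mod n"
        unfolding ix_def by (rule inv_into_f_f[OF n(2)]) (use n(1) in simp)
      then show ?thesis by (simp add: mod_n)
    qed
    \<comment> \<open>The residue modulo \<open>a\<close> of the index of the tail. It does not
      depend on the chosen index because indices are determined modulo \<open>n\<close> and
      \<open>a\<close> divides \<open>n\<close>; rotations add a constant to it.\<close>
    define \<pi> where "\<pi> = (\<lambda>b :: 'v \<times> 'v. ix (fst b) mod a)"
    have \<pi>: "\<pi> (f i, y) = i mod a" for i y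
      using a(1) by (simp add: \<pi>_def ix mod_mod_cancel)
    have A_ex: "\<exists>i. b = (f i, f (Suc i))" if "b \<in> A" for b
    proof -
      obtain x y where b: "b = (x, y)" by (cases b)
      then obtain i where "x = f i"
        using \<open>pverts \<Gamma> \<subseteq> range f\<close> arc_verts(1)[OF sub] \<open>b \<in> A\<close> by blast
      then show ?thesis using b that uniq arc[of i] by blast
    qed
    have "kernel_invariant G A (\<lambda>g. \<lambda>a\<in>A. (\<phi> g (fst a), \<phi> g (snd a))) \<pi>"
      unfolding kernel_invariant_def
    proof (intro ballI impI)
      fix g b b' assume g: "g \<in> carrier G" and b: "b \<in> A" "b' \<in> A" and eq: "\<pi> b = \<pi> b'"
      obtain i where i: "b = (f i, f (Suc i))" using A_ex[OF b(1)] by blast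
      obtain j where j: "b' = (f j, f (Suc j))" using A_ex[OF b(2)] by blast
      obtain c where c: "\<And>i. \<phi> g (f i) = f (i + c)" using shift[OF g] by blast
      have "i mod a = j mod a" using eq unfolding i j \<pi> .
      then have "(i + c) mod a = (j + c) mod a" by (rule mod_add_cong) (rule refl)
      then show "\<pi> ((\<lambda>a\<in>A. (\<phi> g (fst a), \<phi> g (snd a))) b)
          = \<pi> ((\<lambda>a\<in>A. (\<phi> g (fst a), \<phi> g (snd a))) b')"
        using b unfolding i j by (simp add: c \<pi>)
    qed
    moreover have "primitive_action G A (\<lambda>g. \<lambda>a\<in>A. (\<phi> g (fst a), \<phi> g (snd a)))"
      using primitive_on_orientation[OF prim A] antisym closed by blast
    ultimately have "(\<exists>c. \<forall>x\<in>A. \<pi> x = c) \<or> inj_on \<pi> A"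
      using primitive_action_constant_or_inj by blast
    \<comment> \<open>The arcs with indices 0 and 1 have different residues since \<open>a\<close>
      is not 1, and those with indices 0 and \<open>a\<close> are different arcs with equal residue
      since \<open>a\<close> is a divisor other than \<open>n\<close>.\<close>
    then show False
    proof
      assume "\<exists>c. \<forall>x\<in>A. \<pi> x = c"
      then have "\<pi> (f 0, f (Suc 0)) = \<pi> (f 1, f (Suc 1))" using arc by metis
      then show False using \<pi> a by (simp add: mod_Suc split: if_splits)
    next
      assume inj: "inj_on \<pi> A"
      have "\<pi> (f 0, f (Suc 0)) = \<pi> (f a, f (Suc a))" using \<pi> by simp
      then have "f 0 = f a" using inj arc unfolding inj_on_def by blast
      then have "a mod n = 0" using eq_iff by (metis mod_0)
      then show False using a by (metis dvd_antisym mod_0_imp_dvd)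
    qed
  qed
  then show ?thesis using cyc by blast
qed

theorem edge_primitive_imp_arc_transitive:
  assumes prim: "edge_primitive G \<phi> \<Gamma>" and conn: "connected (with_proj \<Gamma>)"
    and nontriv: "\<not> trivial_graph \<Gamma>"
  shows "arc_transitive G \<phi> \<Gamma>"
proof (rule ccontr)
  assume not_trans: "\<not> arc_transitive G \<phi> \<Gamma>"
  obtain u v where uv: "(u, v) \<in> parcs \<Gamma>" using edge_primitive_ex_arc[OF prim] by blast
  note uv_verts = arc_verts[OF uv]
  \<comment> \<open>The orbit of one arc. Edge-transitivity makes this orbit together with its
    reverse the whole arc set.\<close>
  define A where "A = {(\<phi> g u, \<phi> g v) | g. g \<in> carrier G}"
  \<comment> \<open>A group element reversing \<open>(u, v)\<close> would repair every reversed
    image in \<open>edge_transitiveD\<close>, so \<open>(u, v)\<close> could be moved to any arc.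
    Its absence makes \<open>A\<close> antisymmetric.\<close>
  have no_flip: False if g: "g \<in> carrier G" and flip: "\<phi> g u = v" "\<phi> g v = u" for g
  proof -
    have to_uv: "\<exists>k\<in>carrier G. \<phi> k u = x \<and> \<phi> k v = y" if xy: "(x, y) \<in> parcs \<Gamma>" for x y
    proof -
      obtain k where k: "k \<in> carrier G" "\<phi> k u = x \<and> \<phi> k v = y \<or> \<phi> k u = y \<and> \<phi> k v = x"
        using edge_transitiveD[OF prim uv xy] .
      then show ?thesis
      proof (elim disjE)
        assume "\<phi> k u = y \<and> \<phi> k v = x"
        then have "\<phi> (k \<otimes> g) u = x \<and> \<phi> (k \<otimes> g) v = y"
          using k(1) g flip uv_verts by (simp add: V.composition_rule)
        then show ?thesis using k(1) g by blast
      qed blast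
    qed
    have "arc_transitive G \<phi> \<Gamma>"
      unfolding arc_transitive_iff
    proof (intro allI impI)
      fix x y x' y' assume "(x, y) \<in> parcs \<Gamma>" "(x', y') \<in> parcs \<Gamma>"
      then obtain k k' where k: "k \<in> carrier G" "\<phi> k u = x" "\<phi> k v = y"
        and k': "k' \<in> carrier G" "\<phi> k' u = x'" "\<phi> k' v = y'"
        using to_uv by metis
      have "\<phi> (k' \<otimes> inv k) x = x'" "\<phi> (k' \<otimes> inv k) y = y'"
        using k k' uv_verts V.act_closed[OF k(1)] V.act_inv(1)[OF k(1)]
        by (auto simp: V.composition_rule)
      then show "\<exists>g\<in>carrier G. \<phi> g x = x' \<and> \<phi> g y = y'" using k(1) k'(1) by blast
    qed
    then show False using not_trans by blast
  qed
  have uvA: "(u, v) \<in> A" unfolding A_def using V.act_one[OF uv_verts(1)] V.act_one[OF uv_verts(2)] one_closed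
    by (metis (mono_tags, lifting) mem_Collect_eq)
  have sub: "(x, y) \<in> parcs \<Gamma>" if "(x, y) \<in> A" for x y
    using that act_arc uv by (auto simp: A_def)
  have closed: "(\<phi> g x, \<phi> g y) \<in> A" if "g \<in> carrier G" "(x, y) \<in> A" for g x y
  proof -
    obtain k where "k \<in> carrier G" "x = \<phi> k u" "y = \<phi> k v" using \<open>(x, y) \<in> A\<close> by (auto simp: A_def)
    then have "(\<phi> g x, \<phi> g y) = (\<phi> (g \<otimes> k) u, \<phi> (g \<otimes> k) v)" "g \<otimes> k \<in> carrier G"
      using that(1) uv_verts by (auto simp: V.composition_rule)
    then show ?thesis unfolding A_def by blast
  qed
  have to_uv: "\<exists>g\<in>carrier G. \<phi> g x = u \<and> \<phi> g y = v" if xy: "(x, y) \<in> A" for x y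
  proof -
    obtain k where "k \<in> carrier G" "x = \<phi> k u" "y = \<phi> k v" using \<open>(x, y) \<in> A\<close> by (auto simp: A_def)
    then show ?thesis using V.act_inv(1) uv_verts inv_closed by metis
  qed
  have antisym: "(y, x) \<notin> A" if "(x, y) \<in> A" for x y
  proof
    assume "(y, x) \<in> A"
    obtain g where g: "g \<in> carrier G" "\<phi> g x = u" "\<phi> g y = v" using to_uv[OF \<open>(x, y) \<in> A\<close>] by blast
    then have "(v, u) \<in> A" using closed[OF g(1) \<open>(y, x) \<in> A\<close>] by simp
    then obtain k where "k \<in> carrier G" "(v, u) = (\<phi> k u, \<phi> k v)" unfolding A_def by blast
    then show False using no_flip by (metis prod.inject)
  qed
  have A: "A \<union> A\<inverse> = parcs \<Gamma>"
  proof (intro equalityI subsetI)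
    fix a assume a: "a \<in> parcs \<Gamma>"
    obtain x y where xy: "a = (x, y)" by (cases a)
    obtain g where "g \<in> carrier G" "\<phi> g u = x \<and> \<phi> g v = y \<or> \<phi> g u = y \<and> \<phi> g v = x"
      using edge_transitiveD[OF prim uv] a xy by blast
    then show "a \<in> A \<union> A\<inverse>" using xy by (auto simp: A_def)
  qed (use sub arc_sym in auto)
  have primA: "primitive_action G A (\<lambda>g. \<lambda>a\<in>A. (\<phi> g (fst a), \<phi> g (snd a)))"
    using primitive_on_orientation[OF prim A] antisym closed by blast
  have "kernel_invariant G A (\<lambda>g. \<lambda>a\<in>A. (\<phi> g (fst a), \<phi> g (snd a))) fst"
    "kernel_invariant G A (\<lambda>g. \<lambda>a\<in>A. (\<phi> g (fst a), \<phi> g (snd a))) snd"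
    by (auto simp: kernel_invariant_def)
  note dich = this[THEN primitive_action_constant_or_inj[OF primA]]
  have not_star: "\<not> is_star \<Gamma>" using nontriv by (simp add: trivial_graph_def)
  have inj_fst: "inj_on fst A"
  proof (rule ccontr)
    assume "\<not> inj_on fst A"
    then obtain c where "\<forall>x\<in>A. fst x = c" using dich(1) by blast
    then have "\<And>x y. (x, y) \<in> parcs \<Gamma> \<Longrightarrow> x = c \<or> y = c" unfolding A[symmetric] by force
    then show False using not_star is_star_if_common_vertex[OF conn uv] by blast
  qed
  have inj_snd: "inj_on snd A"
  proof (rule ccontr)
    assume "\<not> inj_on snd A"
    then obtain c where "\<forall>x\<in>A. snd x = c" using dich(2) by blast
    then have "\<And>x y. (x, y) \<in> parcs \<Gamma> \<Longrightarrow> x = c \<or> y = c" unfolding A[symmetric] by force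
    then show False using not_star is_star_if_common_vertex[OF conn uv] by blast
  qed
  show False
  \<comment> \<open>The question is whether oriented edges ever compose. If they do,
    \<open>v\<close> is itself a tail and hence an image of \<open>u\<close>, which supplies the
    rotation \<open>h\<close>.\<close>
  proof (cases "\<exists>w. (v, w) \<in> A")
    case True
    then obtain w where vw: "(v, w) \<in> A" by blast
    then obtain h where h: "h \<in> carrier G" "\<phi> h u = v" by (auto simp: A_def)
    have "\<exists>p::nat. prime p \<and> is_cycle_graph p \<Gamma>"
      by (rule oriented_cycle_prime[OF prim conn A _ _ inj_fst inj_snd h(1) uvA vw h(2)])
        (fact antisym closed)+
    then show False using nontriv by (simp add: trivial_graph_def)
  next
    case False
    \<comment> \<open>Since \<open>A\<close> is a single orbit, no head is a tail. Together with the
      uniqueness of arcs of \<open>A\<close> at a given tail or head this isolates the edge on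
      \<open>u\<close> and \<open>v\<close>, leaving the star with one edge.\<close>
    have no_path: "(y, z) \<notin> A" if xy: "(x, y) \<in> A" for x y z
    proof
      assume yz: "(y, z) \<in> A"
      obtain g where g: "g \<in> carrier G" "\<phi> g x = u" "\<phi> g y = v" using to_uv[OF xy] by blast
      then show False using closed[OF g(1) yz] False by auto
    qed
    have "pverts \<Gamma> \<subseteq> {u, v}"
    proof (rule connected_closed[OF conn graph uv_verts(1)])
      fix x y assume "x \<in> {u, v}" "(x, y) \<in> parcs \<Gamma>"
      then have "x = u \<or> x = v" "(x, y) \<in> A \<or> (y, x) \<in> A" using A by auto
      then show "y \<in> {u, v}"
        using uvA no_path[OF uvA] no_path[of y u v] inj_onD[OF inj_fst _ uvA, of "(x, y)"]
          inj_onD[OF inj_snd _ uvA, of "(y, x)"] by auto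
    qed simp
    then have "\<And>x y. (x, y) \<in> parcs \<Gamma> \<Longrightarrow> x = u \<or> y = u" using arc_verts arc_neq by blast
    then show False using not_star is_star_if_common_vertex[OF conn uv] by blast
  qed
qed

end

section \<open>Vertex-imprimitive graphs are spreads\<close>

lemma finite_pair_graphI:
  assumes "finite (pverts \<Gamma>)" "parcs \<Gamma> \<subseteq> pverts \<Gamma> \<times> pverts \<Gamma>"
    and sym: "\<And>u v. (u, v) \<in> parcs \<Gamma> \<Longrightarrow> (v, u) \<in> parcs \<Gamma>"
    and neq: "\<And>u v. (u, v) \<in> parcs \<Gamma> \<Longrightarrow> u \<noteq> v"
  shows "pair_graph \<Gamma>"
proof -
  have "finite (parcs \<Gamma>)" using assms(1,2) by (meson finite_SigmaI finite_subset)
  then show ?thesis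
    by unfold_locales (use assms in \<open>auto simp: symmetric_def sym_def\<close>)
qed

section \<open>Neighbours and the parts of an invariant partition\<close>

context graph_action
begin

text \<open>If \<open>v\<close> had one neighbour, arc-transitivity would bound all valencies by
  one, and connectedness would leave a single edge, which is a star.\<close>

lemma two_neighbours:
  assumes conn: "connected (with_proj \<Gamma>)" and at: "arc_transitive G \<phi> \<Gamma>" and star: "\<not> is_star \<Gamma>"
    and arc: "(v, w) \<in> parcs \<Gamma>"
  obtains w' where "(v, w') \<in> parcs \<Gamma>" "w' \<noteq> w"
proof (rule ccontr)
  assume neg: "\<not> thesis"
  have only: "w' = w" if "(v, w') \<in> parcs \<Gamma>" for w'
    using neg that \<open>\<And>w'. (v, w') \<in> parcs \<Gamma> \<Longrightarrow> w' \<noteq> w \<Longrightarrow> thesis\<close> by blast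
  have uniq: "y = z" if xy: "(x, y) \<in> parcs \<Gamma>" and xz: "(x, z) \<in> parcs \<Gamma>" for x y z
  proof -
    obtain g where g: "g \<in> carrier G" "\<phi> g x = v" "\<phi> g y = w"
      using at xy arc unfolding arc_transitive_iff by blast
    have "\<phi> g z = \<phi> g y" using only act_arc[OF g(1) xz] g(2,3) by simp
    then show ?thesis using inj_onD[OF V.inj_prop[OF g(1)]] arc_verts(2)[OF xy] arc_verts(2)[OF xz] by simp
  qed
  have "pverts \<Gamma> \<subseteq> {v, w}"
  proof (rule connected_closed[OF conn graph arc_verts(1)[OF arc]])
    fix x y assume "x \<in> {v, w}" "(x, y) \<in> parcs \<Gamma>"
    then show "y \<in> {v, w}" using uniq arc arc_sym by blast
  qed simp
  then have "\<And>x y. (x, y) \<in> parcs \<Gamma> \<Longrightarrow> x = v \<or> y = v" using arc_verts arc_neq by blast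
  then show False using star is_star_if_common_vertex[OF conn arc] by blast
qed

text \<open>One arc inside a part forces all arcs inside parts, by arc-transitivity; connectedness
  then merges all vertices into one part.\<close>

lemma part_of_neq_adjacent:
  assumes conn: "connected (with_proj \<Gamma>)" and at: "arc_transitive G \<phi> \<Gamma>"
    and P: "invariant_partition G (pverts \<Gamma>) \<phi> P" "P \<noteq> {pverts \<Gamma>}"
    and arc: "(u, v) \<in> parcs \<Gamma>"
  shows "part_of P u \<noteq> part_of P v"
proof
  assume eq: "part_of P u = part_of P v"
  have all: "part_of P x = part_of P y" if xy: "(x, y) \<in> parcs \<Gamma>" for x y
  proof -
    obtain g where "g \<in> carrier G" "\<phi> g u = x" "\<phi> g v = y"
      using at xy arc unfolding arc_transitive_iff by blast
    then show ?thesis using part_of_act[OF P(1)] arc_verts[OF arc] eq by metis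
  qed
  have "pverts \<Gamma> \<subseteq> {x. part_of P x = part_of P u}"
    by (rule connected_closed[OF conn graph arc_verts(1)[OF arc]]) (use all in auto)
  then have "\<exists>c. \<forall>x\<in>pverts \<Gamma>. part_of P x = c" by blast
  then have "P = {pverts \<Gamma>}"
    using part_of_constant_onD P(1) arc_verts(1)[OF arc] unfolding invariant_partition_def by blast
  then show False using P(2) by blast
qed

end

text \<open>By \<open>neq\<close> no arc lies inside a part, so the clause that makes the quotient
  loopless discards nothing and the quotient arcs are exactly the images of arcs.\<close>

locale graph_quotient = graph_action G \<Gamma> \<phi>
  for G (structure) and \<Gamma> :: "'v pair_pre_digraph" and \<phi> :: "'a \<Rightarrow> 'v \<Rightarrow> 'v" +
  fixes P :: "'v set set"
  assumes inv_part: "invariant_partition G (pverts \<Gamma>) \<phi> P"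
    and neq: "(u, v) \<in> parcs \<Gamma> \<Longrightarrow> part_of P u \<noteq> part_of P v"
begin

abbreviation Q where "Q \<equiv> quotient_graph \<Gamma> P"
abbreviation \<psi> where "\<psi> \<equiv> block_action \<phi> P"

lemma part: "partition_on (pverts \<Gamma>) P"
  using inv_part by (simp add: invariant_partition_def)

lemma quotient_arc_iff:
  "(B, C) \<in> parcs Q \<longleftrightarrow> (\<exists>v w. (v, w) \<in> parcs \<Gamma> \<and> B = part_of P v \<and> C = part_of P w)"
proof
  assume "(B, C) \<in> parcs Q"
  then obtain v w where "B \<in> P" "C \<in> P" "v \<in> B" "w \<in> C" "(v, w) \<in> parcs \<Gamma>"
    by (auto simp: quotient_graph_def)
  then show "\<exists>v w. (v, w) \<in> parcs \<Gamma> \<and> B = part_of P v \<and> C = part_of P w"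
    using part_of_eq[OF part] by metis
next
  assume "\<exists>v w. (v, w) \<in> parcs \<Gamma> \<and> B = part_of P v \<and> C = part_of P w"
  then obtain v w where vw: "(v, w) \<in> parcs \<Gamma>" "B = part_of P v" "C = part_of P w" by blast
  then show "(B, C) \<in> parcs Q"
    using neq[OF vw(1)] part_of_in[OF part arc_verts(1)[OF vw(1)]]
      part_of_in[OF part arc_verts(2)[OF vw(1)]]
    by (auto simp: quotient_graph_def)
qed

lemma pverts_quotient: "pverts Q = P"
  by (simp add: quotient_graph_def)

lemma quotient_graph: "pair_graph Q"
proof (rule finite_pair_graphI)
  show "finite (pverts Q)" using finite_elements[OF finite_pverts part] by (simp add: pverts_quotient)
  show "(C, B) \<in> parcs Q" if "(B, C) \<in> parcs Q" for B C
    using that arc_sym unfolding quotient_arc_iff by blast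
qed (auto simp: quotient_graph_def)

lemma block_act: "B \<in> P \<Longrightarrow> \<psi> g B = \<phi> g ` B"
  by (simp add: block_action_def)

lemma block_act_part_of:
  "g \<in> carrier G \<Longrightarrow> x \<in> pverts \<Gamma> \<Longrightarrow> \<psi> g (part_of P x) = part_of P (\<phi> g x)"
  by (simp add: block_act part_of_in[OF part] part_of_act[OF inv_part])

lemma part_obtain:
  assumes "B \<in> P"
  obtains x where "x \<in> pverts \<Gamma>" "B = part_of P x"
proof -
  obtain x where x: "x \<in> B" using partition_onD3[OF part] assms by (metis ex_in_conv)
  then have "x \<in> pverts \<Gamma>" using partition_onD1[OF part] assms by blast
  then show ?thesis using that part_of_eq[OF part assms x] by blast
qed

lemma block_hom: "\<psi> \<in> hom G (AutGroup Q)"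
proof (rule hom_AutGroupI)
  show "group_action G (pverts Q) \<psi>" unfolding pverts_quotient
  proof (rule group_actionI[OF is_group])
    show "\<psi> g \<in> extensional P" for g by (simp add: block_action_def)
    show "\<psi> g B \<in> P" if "g \<in> carrier G" "B \<in> P" for g B
      using inv_part that by (simp add: block_act invariant_partition_def)
    show "\<psi> \<one> B = B" if "B \<in> P" for B
      using that by (elim part_obtain) (simp add: block_act_part_of V.act_one)
    show "\<psi> (g \<otimes> h) B = \<psi> g (\<psi> h B)" if "g \<in> carrier G" "h \<in> carrier G" "B \<in> P" for g h B
      using that(3,1,2)
      by (elim part_obtain) (simp add: block_act_part_of V.composition_rule V.act_closed)
  qed
  fix g B C assume g: "g \<in> carrier G" and "(B, C) \<in> parcs Q"
  then obtain v w where vw: "(v, w) \<in> parcs \<Gamma>" "B = part_of P v" "C = part_of P w"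
    unfolding quotient_arc_iff by blast
  then have "\<psi> g B = part_of P (\<phi> g v)" "\<psi> g C = part_of P (\<phi> g w)"
    using block_act_part_of[OF g] arc_verts by auto
  then show "(\<psi> g B, \<psi> g C) \<in> parcs Q" unfolding quotient_arc_iff using act_arc[OF g vw(1)] by blast
qed

sublocale Q: graph_action G Q \<psi>
  by (intro graph_action.intro graph_action_axioms.intro is_group quotient_graph block_hom)

lemma arc_transitive_quotient:
  assumes "arc_transitive G \<phi> \<Gamma>"
  shows "arc_transitive G \<psi> Q"
  unfolding Q.arc_transitive_iff
proof (intro allI impI)
  fix B C B' C' assume "(B, C) \<in> parcs Q" "(B', C') \<in> parcs Q"
  then obtain v w v' w' where vw: "(v, w) \<in> parcs \<Gamma>" "B = part_of P v" "C = part_of P w"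
    and vw': "(v', w') \<in> parcs \<Gamma>" "B' = part_of P v'" "C' = part_of P w'"
    unfolding quotient_arc_iff by blast
  obtain g where "g \<in> carrier G" "\<phi> g v = v'" "\<phi> g w = w'"
    using assms vw(1) vw'(1) unfolding arc_transitive_iff by blast
  then show "\<exists>g\<in>carrier G. \<psi> g B = B' \<and> \<psi> g C = C'"
    using block_act_part_of arc_verts[OF vw(1)] vw vw' by metis
qed

lemma edge_image_equivariant:
  assumes "g \<in> carrier G" "e \<in> edge_set \<Gamma>"
  shows "part_of P ` edge_action \<phi> \<Gamma> g e = \<psi> g ` part_of P ` e"
proof -
  obtain u v where "(u, v) \<in> parcs \<Gamma>" "e = {u, v}" using edge_setE[OF assms(2)] .
  then show ?thesis using assms(1) arc_verts by (simp add: edge_action_edge block_act_part_of)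
qed

lemma edge_set_quotient: "edge_set Q = (`) (part_of P) ` edge_set \<Gamma>"
proof (intro equalityI subsetI)
  fix E assume "E \<in> edge_set Q"
  then obtain B C where "(B, C) \<in> parcs Q" "E = {B, C}" by (rule Q.edge_setE)
  then obtain v w where "(v, w) \<in> parcs \<Gamma>" "E = part_of P ` {v, w}"
    unfolding quotient_arc_iff by auto
  then show "E \<in> (`) (part_of P) ` edge_set \<Gamma>" using edge_in_edge_set by blast
next
  fix E assume "E \<in> (`) (part_of P) ` edge_set \<Gamma>"
  then obtain u v where "(u, v) \<in> parcs \<Gamma>" "E = {part_of P u, part_of P v}"
    by (auto elim!: edge_setE)
  then show "E \<in> edge_set Q" using Q.edge_in_edge_set quotient_arc_iff by metis
qed

text \<open>In the constant case all edges join the same two parts. Every part contains an end of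
  some edge, as no vertex is isolated, so these two are all the parts; \<open>neq\<close> makes them
  distinct, contradicting \<open>card\<close>.\<close>

lemma edge_image_inj:
  assumes prim: "edge_primitive G \<phi> \<Gamma>" and conn: "connected (with_proj \<Gamma>)" and card: "card P \<noteq> 2"
  shows "inj_on ((`) (part_of P)) (edge_set \<Gamma>)"
proof (rule ccontr)
  let ?\<rho> = "(`) (part_of P)"
  assume not_inj: "\<not> inj_on ?\<rho> (edge_set \<Gamma>)"
  have "kernel_invariant G (edge_set \<Gamma>) (edge_action \<phi> \<Gamma>) ?\<rho>"
    unfolding kernel_invariant_def by (auto simp: edge_image_equivariant)
  then obtain c where c: "\<And>e. e \<in> edge_set \<Gamma> \<Longrightarrow> ?\<rho> e = c"
    using primitive_action_constant_or_inj not_inj prim unfolding edge_primitive_def by metis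
  obtain u v where uv: "(u, v) \<in> parcs \<Gamma>" using edge_primitive_ex_arc[OF prim] by blast
  have "P = {part_of P u, part_of P v}"
  proof (intro equalityI subsetI)
    fix B assume "B \<in> P"
    then obtain x where x: "x \<in> pverts \<Gamma>" "B = part_of P x" by (rule part_obtain)
    obtain y where "(x, y) \<in> parcs \<Gamma>" using connected_no_isolated[OF conn uv x(1)] .
    then have "?\<rho> {x, y} = ?\<rho> {u, v}" using c edge_in_edge_set uv by metis
    then show "B \<in> {part_of P u, part_of P v}" using x by auto
  qed (use part_of_in[OF part] arc_verts[OF uv] in auto)
  then have "card P = 2" using neq[OF uv] by (metis card_2_iff)
  then show False using card by blast
qed

end

text \<open>Injectivity on unordered edges is the form in which the dichotomy delivers the spread
  property; the lemma \<open>arc_unique\<close> restores the directions.\<close>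

locale graph_spread = graph_quotient +
  assumes inj: "inj_on ((`) (part_of P)) (edge_set \<Gamma>)"
begin

lemma arc_unique:
  assumes "(v, w) \<in> parcs \<Gamma>" "(v', w') \<in> parcs \<Gamma>"
    "part_of P v = part_of P v'" "part_of P w = part_of P w'"
  shows "v = v' \<and> w = w'"
proof -
  have "part_of P ` {v, w} = part_of P ` {v', w'}" using assms by simp
  then have "{v, w} = {v', w'}"
    by (rule inj_onD[OF inj _ edge_in_edge_set[OF assms(1)] edge_in_edge_set[OF assms(2)]])
  \<comment> \<open>Equal edges could still be reversed; then \<open>w = v'\<close> would lie in the
    part of \<open>v\<close>, which \<open>neq\<close> forbids.\<close>
  then show ?thesis using neq[OF assms(1)] assms(4) by (auto simp: doubleton_eq_iff)
qed

lemma spread: "spread_of_quotient \<Gamma> P"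
  unfolding spread_of_quotient_def
proof (intro ballI, clarify)
  fix B C assume BC: "(B, C) \<in> parcs Q"
  then obtain v w where vw: "(v, w) \<in> parcs \<Gamma>" "B = part_of P v" "C = part_of P w"
    unfolding quotient_arc_iff by blast
  have "B \<in> P" "C \<in> P" using BC by (auto simp: quotient_graph_def)
  note eq = part_of_eq[OF part this(1)] part_of_eq[OF part this(2)]
  show "\<exists>!a. a \<in> parcs \<Gamma> \<and> fst a \<in> B \<and> snd a \<in> C"
  proof (rule ex1I[of _ "(v, w)"])
    show "(v, w) \<in> parcs \<Gamma> \<and> fst (v, w) \<in> B \<and> snd (v, w) \<in> C"
      unfolding vw(2,3) fst_conv snd_conv
      by (intro conjI vw(1) part_of_in(2)[OF part] arc_verts[OF vw(1)])
    fix a assume a: "a \<in> parcs \<Gamma> \<and> fst a \<in> B \<and> snd a \<in> C"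
    then have "part_of P (fst a) = part_of P v" "part_of P (snd a) = part_of P w"
      using eq[of "fst a"] eq(2)[of "snd a"] vw(2,3) by simp_all
    then have "fst a = v \<and> snd a = w" using arc_unique[of "fst a" "snd a" v w] a vw(1) by simp
    then show "a = (v, w)" by (simp add: prod_eq_iff)
  qed
qed

lemma edge_primitive_quotient:
  assumes "edge_primitive G \<phi> \<Gamma>"
  shows "edge_primitive G \<psi> Q"
  unfolding edge_primitive_def
proof (rule primitive_action_bij)
  show "primitive_action G (edge_set \<Gamma>) (edge_action \<phi> \<Gamma>)"
    using assms by (simp add: edge_primitive_def)
  show "bij_betw ((`) (part_of P)) (edge_set \<Gamma>) (edge_set Q)"
    using inj edge_set_quotient by (simp add: bij_betw_def)
  show "group_action G (edge_set Q) (edge_action \<psi> Q)" by (rule Q.edge.group_action_axioms)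
  fix g e assume ge: "g \<in> carrier G" "e \<in> edge_set \<Gamma>"
  then have "part_of P ` e \<in> edge_set Q" using edge_set_quotient by blast
  then show "part_of P ` edge_action \<phi> \<Gamma> g e = edge_action \<psi> Q g (part_of P ` e)"
    using edge_image_equivariant[OF ge] by (simp add: edge_action_def)
qed

text \<open>Elements with the same effect on parts send an arc to two arcs between the same parts,
  which therefore coincide; every vertex lies on an arc.\<close>

lemma block_action_inj:
  assumes "inj_on \<phi> (carrier G)" "\<And>v. v \<in> pverts \<Gamma> \<Longrightarrow> \<exists>w. (v, w) \<in> parcs \<Gamma>"
  shows "inj_on \<psi> (carrier G)"
proof (rule inj_onI)
  fix g h assume g: "g \<in> carrier G" and h: "h \<in> carrier G" and eq: "\<psi> g = \<psi> h"
  have "\<phi> g x = \<phi> h x" if x: "x \<in> pverts \<Gamma>" for x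
  proof -
    obtain y where xy: "(x, y) \<in> parcs \<Gamma>" using assms(2)[OF x] by blast
    have "part_of P (\<phi> g z) = part_of P (\<phi> h z)" if "z \<in> pverts \<Gamma>" for z
      using block_act_part_of[OF g that] block_act_part_of[OF h that] eq by simp
    then show ?thesis using arc_unique[OF act_arc[OF g xy] act_arc[OF h xy]] arc_verts[OF xy] by blast
  qed
  then have "\<phi> g = \<phi> h"
    using extensionalityI Bij_imp_extensional V.bij_prop0 g h by metis
  then show "g = h" using assms(1) g h by (simp add: inj_on_eq_iff)
qed

text \<open>The local block system is nontrivial for two separate reasons: \<open>B\<close> has at
  least two vertices, each with neighbours, and each vertex of \<open>B\<close> has at least two
  neighbours.\<close>

lemma locally_imprimitive_quotient:
  assumes conn: "connected (with_proj \<Gamma>)" and at: "arc_transitive G \<phi> \<Gamma>" and star: "\<not> is_star \<Gamma>"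
    and ex: "(a, b) \<in> parcs \<Gamma>" and P: "P \<noteq> (\<lambda>x. {x}) ` pverts \<Gamma>"
  shows "locally_imprimitive G \<psi> Q"
  unfolding locally_imprimitive_def
proof
  fix B assume "B \<in> pverts Q"
  then have B: "B \<in> P" by (simp add: pverts_quotient)
  let ?S = "G\<lparr>carrier := stabilizer G \<psi> B\<rparr>"
  interpret local: group_action ?S "nbrs Q B" "local_action \<psi> Q B"
    by (rule Q.local_group_action) fact
  have nbr: "\<exists>w. (v, w) \<in> parcs \<Gamma>" if "v \<in> pverts \<Gamma>" for v
    using connected_no_isolated[OF conn ex that] by blast
  \<comment> \<open>The end in \<open>B\<close> of the arc joining \<open>B\<close> to
    \<open>C\<close>; the description is proper on neighbours of \<open>B\<close> because that arc
    is unique.\<close>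
  define \<tau> where "\<tau> = (\<lambda>C. THE v. \<exists>w. (v, w) \<in> parcs \<Gamma> \<and> part_of P v = B \<and> part_of P w = C)"
  have \<tau>: "\<tau> (part_of P w) = v" if "(v, w) \<in> parcs \<Gamma>" "part_of P v = B" for v w
    unfolding \<tau>_def
    by (rule the_equality) (use that arc_unique in \<open>metis+\<close>)
  have nbrsE: "\<exists>v w. (v, w) \<in> parcs \<Gamma> \<and> part_of P v = B \<and> C = part_of P w" if "C \<in> nbrs Q B" for C
    using that unfolding nbrs_def quotient_arc_iff by blast
  have nbrsI: "part_of P w \<in> nbrs Q B" if "(v, w) \<in> parcs \<Gamma>" "part_of P v = B" for v w
    using that unfolding nbrs_def quotient_arc_iff by blast
  have tau_equi: "\<tau> (local_action \<psi> Q B g C) = \<phi> g (\<tau> C)"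
    if g: "g \<in> stabilizer G \<psi> B" and C: "C \<in> nbrs Q B" for g C
  proof -
    obtain v w where vw: "(v, w) \<in> parcs \<Gamma>" "part_of P v = B" "C = part_of P w" using nbrsE[OF C] by blast
    have gG: "g \<in> carrier G" "\<psi> g B = B" using g by (auto simp: stabilizer_def)
    have "local_action \<psi> Q B g C = part_of P (\<phi> g w)"
      using C vw block_act_part_of[OF gG(1)] arc_verts by (simp add: local_action_def)
    moreover have "part_of P (\<phi> g v) = B"
      using block_act_part_of[OF gG(1)] arc_verts[OF vw(1)] vw(2) gG(2) by metis
    ultimately show ?thesis using \<tau>[OF act_arc[OF gG(1) vw(1)]] \<tau>[OF vw(1,2)] vw(3) by simp
  qed
  have "nontrivial_system ?S (nbrs Q B) (local_action \<psi> Q B) (fibres (nbrs Q B) \<tau>)"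
  proof (rule local.nontrivial_system_fibres)
    show "kernel_invariant ?S (nbrs Q B) (local_action \<psi> Q B) \<tau>"
      by (simp add: kernel_invariant_def tau_equi)
    interpret trans: transitive_action G "pverts \<Gamma>" \<phi>
      by (rule arc_transitive_imp_vertex_transitive[OF at nbr])
    \<comment> \<open>\<open>P\<close> is not the partition into singletons, so some part has two
      vertices; vertex-transitivity moves that part onto \<open>B\<close>.\<close>
    obtain x y where xy: "x \<in> pverts \<Gamma>" "y \<in> pverts \<Gamma>" "part_of P x = part_of P y" "x \<noteq> y"
      using part_of_inj_onD[OF part] P by (auto simp: inj_on_def)
    obtain z where z: "z \<in> pverts \<Gamma>" "B = part_of P z" using part_obtain[OF B] .
    obtain g where g: "g \<in> carrier G" "\<phi> g x = z" using trans.unique_orbit[OF xy(1) z(1)] by blast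
    have y': "\<phi> g y \<in> pverts \<Gamma>" "part_of P (\<phi> g y) = B"
      using V.act_closed[OF g(1) xy(2)] part_of_act[OF inv_part g(1)] xy g z by auto
    have "\<phi> g y \<noteq> z" using inj_onD[OF V.inj_prop[OF g(1)]] xy g(2) by metis
    moreover obtain z1 where z1: "(z, z1) \<in> parcs \<Gamma>" using nbr[OF z(1)] by blast
    moreover obtain y1 where y1: "(\<phi> g y, y1) \<in> parcs \<Gamma>" using nbr[OF y'(1)] by blast
    ultimately have "\<tau> (part_of P z1) \<noteq> \<tau> (part_of P y1)"
      using \<tau>[OF z1 z(2)[symmetric]] \<tau>[OF y1 y'(2)] by simp
    then show "\<nexists>c. \<forall>x\<in>nbrs Q B. \<tau> x = c"
      using nbrsI[OF z1 z(2)[symmetric]] nbrsI[OF y1 y'(2)] by metis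
    \<comment> \<open>A second neighbour of \<open>z\<close> lies in a different part, since
      otherwise two arcs would join the same pair of parts. Both parts are sent to \<open>z\<close>
      by \<open>\<tau>\<close>.\<close>
    obtain z2 where z2: "(z, z2) \<in> parcs \<Gamma>" "z2 \<noteq> z1" using two_neighbours[OF conn at star z1] .
    have "part_of P z1 \<noteq> part_of P z2" using arc_unique[OF z1 z2(1)] z2(2) by blast
    then show "\<not> inj_on \<tau> (nbrs Q B)"
      using \<tau>[OF z1 z(2)[symmetric]] \<tau>[OF z2(1) z(2)[symmetric]]
        nbrsI[OF z1 z(2)[symmetric]] nbrsI[OF z2(1) z(2)[symmetric]] unfolding inj_on_def by metis
  qed
  moreover have "transitive_action ?S (nbrs Q B) (local_action \<psi> Q B)"
    by (rule Q.transitive_local_action[OF arc_transitive_quotient[OF at]]) fact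
  moreover have "nbrs Q B \<noteq> {}"
  proof -
    obtain z where z: "z \<in> pverts \<Gamma>" "B = part_of P z" using part_obtain[OF B] .
    then show ?thesis using nbr[OF z(1)] nbrsI by blast
  qed
  ultimately show "imprimitive_action ?S (nbrs Q B) (local_action \<psi> Q B)"
    unfolding imprimitive_action_def by blast
qed

end

theorem (in graph_action) vertex_imprimitive_imp_spread:
  assumes prim: "edge_primitive G \<phi> \<Gamma>" and conn: "connected (with_proj \<Gamma>)"
    and nontriv: "\<not> trivial_graph \<Gamma>" and faithful: "inj_on \<phi> (carrier G)"
    and not_prim: "\<not> vertex_primitive G \<phi> \<Gamma>" and not_biprim: "\<not> vertex_biprimitive G \<phi> \<Gamma>"
  obtains P where "invariant_partition G (pverts \<Gamma>) \<phi> P" "spread_of_quotient \<Gamma> P"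
    "pair_graph (quotient_graph \<Gamma> P)"
    "block_action \<phi> P \<in> mon G (AutGroup (quotient_graph \<Gamma> P))"
    "edge_primitive G (block_action \<phi> P) (quotient_graph \<Gamma> P)"
    "locally_imprimitive G (block_action \<phi> P) (quotient_graph \<Gamma> P)"
proof -
  have at: "arc_transitive G \<phi> \<Gamma>" by (rule edge_primitive_imp_arc_transitive[OF prim conn nontriv])
  obtain a b where ab: "(a, b) \<in> parcs \<Gamma>" using edge_primitive_ex_arc[OF prim] by blast
  have nbr: "\<exists>w. (v, w) \<in> parcs \<Gamma>" if "v \<in> pverts \<Gamma>" for v
    using connected_no_isolated[OF conn ab that] by blast
  have "transitive_action G (pverts \<Gamma>) \<phi>" by (rule arc_transitive_imp_vertex_transitive[OF at nbr])
  moreover have "pverts \<Gamma> \<noteq> {}" using arc_verts[OF ab] by blast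
  \<comment> \<open>Since the action on vertices is transitive, failing to be primitive yields a
    nontrivial system, and failing to be biprimitive then yields one whose number of parts is not
    two.\<close>
  ultimately obtain P where P: "nontrivial_system G (pverts \<Gamma>) \<phi> P" "card P \<noteq> 2"
    using not_prim not_biprim
    unfolding vertex_primitive_def vertex_biprimitive_def primitive_action_def
      biprimitive_action_def imprimitive_action_def by blast
  then have invP: "invariant_partition G (pverts \<Gamma>) \<phi> P" "P \<noteq> {pverts \<Gamma>}"
    "P \<noteq> (\<lambda>x. {x}) ` pverts \<Gamma>"
    by (auto simp: nontrivial_system_def)
  interpret graph_quotient G \<Gamma> \<phi> P
    by unfold_locales (use invP(1) part_of_neq_adjacent[OF conn at invP(1,2)] in auto)
  interpret graph_spread G \<Gamma> \<phi> P
    by unfold_locales (rule edge_image_inj[OF prim conn P(2)])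
  have star: "\<not> is_star \<Gamma>" using nontriv by (simp add: trivial_graph_def)
  show thesis
    using that[OF invP(1) spread quotient_graph _ edge_primitive_quotient[OF prim]
        locally_imprimitive_quotient[OF conn at star ab invP(3)]]
      block_hom block_action_inj[OF faithful nbr] by (simp add: mon_def)
qed

section \<open>Splitting vertices along local blocks\<close>

context graph_action
begin

lemma comp_act:
  assumes g: "g \<in> carrier G" and x: "x \<in> pverts \<Gamma>"
  shows "(parcs \<Gamma>)\<^sup>* `` {\<phi> g x} = \<phi> g ` ((parcs \<Gamma>)\<^sup>* `` {x})"
proof -
  have fwd: "y \<in> pverts \<Gamma> \<and> (\<phi> h x, \<phi> h y) \<in> (parcs \<Gamma>)\<^sup>*"
    if h: "h \<in> carrier G" and xy: "(x, y) \<in> (parcs \<Gamma>)\<^sup>*" and xV: "x \<in> pverts \<Gamma>" for h x y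
    using xy
  proof (induction rule: rtrancl_induct)
    case (step y z)
    then show ?case using act_arc[OF h step(2)] arc_verts[OF step(2)] by (meson rtrancl.rtrancl_into_rtrancl)
  qed (use xV in simp)
  have gx: "\<phi> g x \<in> pverts \<Gamma>" using V.act_closed[OF g x] .
  show ?thesis
  proof (intro equalityI subsetI)
    fix y assume "y \<in> (parcs \<Gamma>)\<^sup>* `` {\<phi> g x}"
    then have y: "(\<phi> g x, y) \<in> (parcs \<Gamma>)\<^sup>*" by simp
    have "y \<in> pverts \<Gamma>" "(\<phi> (inv g) (\<phi> g x), \<phi> (inv g) y) \<in> (parcs \<Gamma>)\<^sup>*"
      using fwd[OF inv_closed[OF g] y gx] by auto
    then have "\<phi> g (\<phi> (inv g) y) = y" "(x, \<phi> (inv g) y) \<in> (parcs \<Gamma>)\<^sup>*"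
      using V.act_inv[OF g] x by auto
    then show "y \<in> \<phi> g ` ((parcs \<Gamma>)\<^sup>* `` {x})" by (metis Image_singleton_iff imageI)
  qed (use fwd[OF g _ x] in auto)
qed

text \<open>Two edges at \<open>u\<close> share their component, which excludes the injective
  alternative. With one component carrying all edges, the absence of isolated vertices puts every
  vertex into it.\<close>

lemma edge_primitive_imp_connected:
  assumes prim: "edge_primitive G \<phi> \<Gamma>"
    and nbr: "\<And>v. v \<in> pverts \<Gamma> \<Longrightarrow> \<exists>w. (v, w) \<in> parcs \<Gamma>"
    and two: "(u, v) \<in> parcs \<Gamma>" "(u, w) \<in> parcs \<Gamma>" "v \<noteq> w"
  shows "connected (with_proj \<Gamma>)"
proof -
  interpret pair_graph \<Gamma> by (rule graph)
  let ?comp = "\<lambda>x. (parcs \<Gamma>)\<^sup>* `` {x}"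
  \<comment> \<open>Taking the union over both ends makes this a function of the unordered edge; the
    two ends of an edge have the same component.\<close>
  define \<pi> where "\<pi> = (\<lambda>e. \<Union>x\<in>e. ?comp x)"
  have \<pi>_edge: "\<pi> {x, y} = ?comp x" if "(x, y) \<in> parcs \<Gamma>" for x y
  proof -
    have "?comp y \<subseteq> ?comp x" using that by (auto intro: converse_rtrancl_into_rtrancl)
    then show ?thesis by (auto simp: \<pi>_def)
  qed
  have equi: "\<pi> (edge_action \<phi> \<Gamma> g e) = \<phi> g ` \<pi> e" if "g \<in> carrier G" "e \<in> edge_set \<Gamma>" for g e
  proof -
    obtain x y where "(x, y) \<in> parcs \<Gamma>" "e = {x, y}" using edge_setE[OF \<open>e \<in> edge_set \<Gamma>\<close>] .
    then show ?thesis
      using that(1) by (simp add: edge_action_edge \<pi>_edge act_arc comp_act arc_verts)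
  qed
  then have "kernel_invariant G (edge_set \<Gamma>) (edge_action \<phi> \<Gamma>) \<pi>"
    unfolding kernel_invariant_def by auto
  then have "(\<exists>c. \<forall>e\<in>edge_set \<Gamma>. \<pi> e = c) \<or> inj_on \<pi> (edge_set \<Gamma>)"
    using primitive_action_constant_or_inj prim unfolding edge_primitive_def by blast
  moreover have "\<not> inj_on \<pi> (edge_set \<Gamma>)"
  proof
    assume inj: "inj_on \<pi> (edge_set \<Gamma>)"
    have "{u, v} = {u, w}"
      by (rule inj_onD[OF inj _ edge_in_edge_set[OF two(1)] edge_in_edge_set[OF two(2)]])
        (simp add: \<pi>_edge two)
    then show False using two(3) by (auto simp: doubleton_eq_iff)
  qed
  ultimately obtain c where c: "\<And>e. e \<in> edge_set \<Gamma> \<Longrightarrow> \<pi> e = c" by blast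
  have comp_c: "?comp x = c" if x: "x \<in> pverts \<Gamma>" for x
  proof -
    obtain y where "(x, y) \<in> parcs \<Gamma>" using nbr[OF x] by blast
    then show ?thesis using c[OF edge_in_edge_set] \<pi>_edge by metis
  qed
  have reach: "x \<rightarrow>\<^sup>*\<^bsub>with_proj \<Gamma>\<^esub> y" if "x \<in> pverts \<Gamma>" "(x, y) \<in> (parcs \<Gamma>)\<^sup>*" for x y
    using that(2)
  proof (induction rule: rtrancl_induct)
    case base
    then show ?case using that(1) by simp
  next
    case (step y z)
    then show ?case using reachable_adj_trans by simp
  qed
  have "strongly_connected (with_proj \<Gamma>)"
    unfolding strongly_connected_def
  proof (intro conjI ballI)
    show "verts (with_proj \<Gamma>) \<noteq> {}" using arc_verts(1)[OF two(1)] by auto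
    fix x y assume "x \<in> verts (with_proj \<Gamma>)" "y \<in> verts (with_proj \<Gamma>)"
    then have xy: "x \<in> pverts \<Gamma>" "y \<in> pverts \<Gamma>" by auto
    then have "?comp x = ?comp y" using comp_c by simp
    then have "(x, y) \<in> (parcs \<Gamma>)\<^sup>*" by (metis Image_singleton_iff rtrancl.rtrancl_refl)
    then show "x \<rightarrow>\<^sup>*\<^bsub>with_proj \<Gamma>\<^esub> y" using reach xy(1) by blast
  qed
  then show ?thesis
    unfolding connected_def strongly_connected_def
    using reachable_mk_symmetric_eq[OF pair_sym_arcs] by simp
qed

end

section \<open>Valencies of locally imprimitive graphs\<close>

lemma nontrivial_systemE:
  assumes "nontrivial_system G \<Omega> \<phi> P" "\<Omega> \<noteq> {}"
  obtains x y z where "x \<in> \<Omega>" "y \<in> \<Omega>" "z \<in> \<Omega>" "x \<noteq> y" "part_of P x = part_of P y"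
    "part_of P x \<noteq> part_of P z"
proof -
  have part: "partition_on \<Omega> P"
    using assms(1) by (simp add: nontrivial_system_def invariant_partition_def)
  have "\<not> inj_on (part_of P) \<Omega>"
    using part_of_inj_onD[OF part] assms(1) by (auto simp: nontrivial_system_def)
  then obtain x y where xy: "x \<in> \<Omega>" "y \<in> \<Omega>" "x \<noteq> y" "part_of P x = part_of P y"
    by (auto simp: inj_on_def)
  have "\<nexists>c. \<forall>x\<in>\<Omega>. part_of P x = c"
    using part_of_constant_onD[OF part _ assms(2)] assms(1) by (auto simp: nontrivial_system_def)
  then obtain z where "z \<in> \<Omega>" "part_of P z \<noteq> part_of P x" by blast
  then show ?thesis using that xy by metis
qed

text \<open>A part with two points and a point outside it already account for three
  elements.\<close>

lemma nontrivial_system_card: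
  assumes "nontrivial_system G \<Omega> \<phi> P" "\<Omega> \<noteq> {}" "finite \<Omega>"
  shows "3 \<le> card \<Omega>"
proof -
  obtain x y z where xyz: "x \<in> \<Omega>" "y \<in> \<Omega>" "z \<in> \<Omega>" "x \<noteq> y" "part_of P x = part_of P y"
    "part_of P x \<noteq> part_of P z"
    using nontrivial_systemE[OF assms(1,2)] .
  then have "x \<noteq> z" "y \<noteq> z" by metis+
  then have "card {x, y, z} = 3" using \<open>x \<noteq> y\<close> by simp
  moreover have "card {x, y, z} \<le> card \<Omega>" using xyz(1-3) assms(3) by (intro card_mono) auto
  ultimately show ?thesis by simp
qed

context graph_action
begin

lemma locally_imprimitive_valency:
  assumes "locally_imprimitive G \<phi> \<Gamma>" "v \<in> pverts \<Gamma>"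
  shows "3 \<le> card (nbrs \<Gamma> v)"
proof -
  have "finite (nbrs \<Gamma> v)" using nbrs_subset finite_pverts finite_subset by blast
  then show ?thesis
    using assms nontrivial_system_card unfolding locally_imprimitive_def imprimitive_action_def by metis
qed

text \<open>Leaves of a star have valency one and vertices of a cycle valency at most two, below the
  bound of three. This admits the graph to the arc-transitivity theorem.\<close>

lemma locally_imprimitive_nontrivial:
  assumes "locally_imprimitive G \<phi> \<Gamma>" "(a, b) \<in> parcs \<Gamma>"
  shows "\<not> trivial_graph \<Gamma>"
proof
  note val = locally_imprimitive_valency[OF assms(1)]
  assume "trivial_graph \<Gamma>"
  then consider n where "K\<^bsub>1,n\<^esub> (with_proj \<Gamma>)" | n where "is_cycle_graph n \<Gamma>"
    unfolding trivial_graph_def is_star_def by blast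
  then show False
  proof cases
    case 1
    then obtain U W where UW: "pverts \<Gamma> = U \<union> W" "U \<inter> W = {}" "card U = 1"
      "parcs \<Gamma> = U \<times> W \<union> W \<times> U"
      unfolding complete_bipartite_digraph_pair_def by blast
    \<comment> \<open>A leaf: \<open>U\<close> holds only the centre, so the neighbourhood of any
      vertex of \<open>W\<close> has one element.\<close>
    obtain w where w: "w \<in> W" using UW(4) assms(2) by auto
    then have "nbrs \<Gamma> w = U" using UW(2,4) by (auto simp: nbrs_def)
    then show False using val[of w] w UW(1,3) by simp
  next
    case (2 n)
    then obtain f where f: "3 \<le> n" "bij_betw f {0..<n} (pverts \<Gamma>)"
      "parcs \<Gamma> = {(f i, f j) | i j. i < n \<and> j < n \<and> (j = (i + 1) mod n \<or> i = (j + 1) mod n)}"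
      unfolding is_cycle_graph_def by blast
    have "nbrs \<Gamma> (f 0) \<subseteq> {f 1, f (n - 1)}"
    proof
      fix w assume "w \<in> nbrs \<Gamma> (f 0)"
      then obtain i j where ij: "f 0 = f i" "w = f j" "i < n" "j < n"
        "j = (i + 1) mod n \<or> i = (j + 1) mod n"
        unfolding nbrs_def f(3) by blast
      then have "i = 0" using f(1,2) by (auto simp: bij_betw_def inj_on_def)
      then have "j = 1 \<or> j = n - 1"
        using ij(4,5) f(1) by (cases "j + 1 = n") auto
      then show "w \<in> {f 1, f (n - 1)}" using ij(2) by blast
    qed
    then have "card (nbrs \<Gamma> (f 0)) \<le> card {f 1, f (n - 1)}" by (rule card_mono[rotated]) simp
    also have "\<dots> \<le> 2" by (simp add: card_insert_if)
    finally show False using val[of "f 0"] f(1) bij_betwE[OF f(2)] by force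
  qed
qed

text \<open>Valency at least three supplies both inputs of the component argument, namely two edges
  at a common vertex and the absence of isolated vertices.\<close>

lemma locally_imprimitive_imp_connected:
  assumes prim: "edge_primitive G \<phi> \<Gamma>" and loc: "locally_imprimitive G \<phi> \<Gamma>"
  shows "connected (with_proj \<Gamma>)"
proof -
  note val = locally_imprimitive_valency[OF loc]
  obtain u v where uv: "(u, v) \<in> parcs \<Gamma>" using edge_primitive_ex_arc[OF prim] by blast
  have "\<not> nbrs \<Gamma> u \<subseteq> {v}"
  proof
    assume "nbrs \<Gamma> u \<subseteq> {v}"
    then have "card (nbrs \<Gamma> u) \<le> card {v}" by (rule card_mono[rotated]) simp
    then show False using val[OF arc_verts(1)[OF uv]] by simp
  qed
  then obtain w where "(u, w) \<in> parcs \<Gamma>" "v \<noteq> w" by (auto simp: nbrs_def)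
  moreover have "\<exists>w. (x, w) \<in> parcs \<Gamma>" if "x \<in> pverts \<Gamma>" for x
  proof -
    have "nbrs \<Gamma> x \<noteq> {}" using val[OF that] by force
    then show ?thesis by (auto simp: nbrs_def)
  qed
  ultimately show ?thesis using edge_primitive_imp_connected[OF prim _ uv] by blast
qed

end

text \<open>Conjugation by \<open>L\<close> takes \<open>\<alpha> g\<close> to
  \<open>\<beta> g\<close>. Being defined on permutations rather than on elements of
  \<open>G\<close>, it needs no choice of a preimage when the actions have a kernel.\<close>

lemma induced_groups_iso:
  assumes "group_action G \<Omega> \<alpha>" "group_action G \<Omega>' \<beta>" and bij: "bij_betw L \<Omega> \<Omega>'"
    and equi: "\<And>g x. g \<in> carrier G \<Longrightarrow> x \<in> \<Omega> \<Longrightarrow> L (\<alpha> g x) = \<beta> g (L x)"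
  shows "(BijGroup \<Omega>)\<lparr>carrier := \<alpha> ` carrier G\<rparr> \<cong> (BijGroup \<Omega>')\<lparr>carrier := \<beta> ` carrier G\<rparr>"
proof (rule is_isoI)
  interpret a: group_action G \<Omega> \<alpha> by fact
  interpret b: group_action G \<Omega>' \<beta> by fact
  interpret group G by (rule a.group_G)
  interpret ah: group_hom G "BijGroup \<Omega>" \<alpha> by (rule a.group_hom)
  interpret bh: group_hom G "BijGroup \<Omega>'" \<beta> by (rule b.group_hom)
  let ?F = "\<lambda>s. \<lambda>y\<in>\<Omega>'. L (s (inv_into \<Omega> L y))"
  have inv_L: "inv_into \<Omega> L y \<in> \<Omega>" "L (inv_into \<Omega> L y) = y" if "y \<in> \<Omega>'" for y
    using bij_betwE[OF bij_betw_inv_into[OF bij]] bij_betw_inv_into_right[OF bij] that by auto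
  have F: "?F (\<alpha> g) = \<beta> g" if g: "g \<in> carrier G" for g
  proof (rule extensionalityI[where A = \<Omega>'])
    show "\<beta> g \<in> extensional \<Omega>'" using b.bij_prop0[OF g] by (rule Bij_imp_extensional)
    show "?F (\<alpha> g) y = \<beta> g y" if "y \<in> \<Omega>'" for y using equi[OF g] inv_L[OF that] that by simp
  qed simp
  have "inj_on ?F (\<alpha> ` carrier G)"
  proof (rule inj_onI, clarify)
    fix g h assume g: "g \<in> carrier G" and h: "h \<in> carrier G" and "?F (\<alpha> g) = ?F (\<alpha> h)"
    then have eq: "\<beta> g = \<beta> h" using F by metis
    have "\<alpha> g x = \<alpha> h x" if x: "x \<in> \<Omega>" for x
    proof (rule inj_onD[OF bij_betw_imp_inj_on[OF bij]])
      show "L (\<alpha> g x) = L (\<alpha> h x)" using equi[OF g x] equi[OF h x] eq by simp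
    qed (use a.act_closed g h x in auto)
    then show "\<alpha> g = \<alpha> h"
      using extensionalityI Bij_imp_extensional a.bij_prop0 g h by metis
  qed
  moreover have "?F ` \<alpha> ` carrier G = \<beta> ` carrier G"
    unfolding image_image by (rule image_cong[OF refl F])
  moreover have "?F \<in> hom ((BijGroup \<Omega>)\<lparr>carrier := \<alpha> ` carrier G\<rparr>)
      ((BijGroup \<Omega>')\<lparr>carrier := \<beta> ` carrier G\<rparr>)"
  proof (rule homI)
    fix s assume "s \<in> carrier ((BijGroup \<Omega>)\<lparr>carrier := \<alpha> ` carrier G\<rparr>)"
    then obtain g where "g \<in> carrier G" "s = \<alpha> g" by auto
    then show "?F s \<in> carrier ((BijGroup \<Omega>')\<lparr>carrier := \<beta> ` carrier G\<rparr>)"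
      using F[of g] by simp
  next
    fix s t
    assume "s \<in> carrier ((BijGroup \<Omega>)\<lparr>carrier := \<alpha> ` carrier G\<rparr>)"
      "t \<in> carrier ((BijGroup \<Omega>)\<lparr>carrier := \<alpha> ` carrier G\<rparr>)"
    then obtain g h where g: "g \<in> carrier G" "s = \<alpha> g" and h: "h \<in> carrier G" "t = \<alpha> h" by auto
    have "?F (s \<otimes>\<^bsub>BijGroup \<Omega>\<^esub> t) = ?F (\<alpha> (g \<otimes>\<^bsub>G\<^esub> h))"
      using g h ah.hom_mult by simp
    also have "\<dots> = \<beta> (g \<otimes>\<^bsub>G\<^esub> h)" using F[of "g \<otimes>\<^bsub>G\<^esub> h"] g h by blast
    also have "\<dots> = \<beta> g \<otimes>\<^bsub>BijGroup \<Omega>'\<^esub> \<beta> h" using g h bh.hom_mult by simp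
    also have "\<dots> = ?F s \<otimes>\<^bsub>BijGroup \<Omega>'\<^esub> ?F t" using F[OF g(1)] F[OF h(1)] g(2) h(2) by simp
    finally show "?F (s \<otimes>\<^bsub>(BijGroup \<Omega>)\<lparr>carrier := \<alpha> ` carrier G\<rparr>\<^esub> t)
        = ?F s \<otimes>\<^bsub>(BijGroup \<Omega>')\<lparr>carrier := \<beta> ` carrier G\<rparr>\<^esub> ?F t" by simp
  qed
  ultimately show "?F \<in> iso ((BijGroup \<Omega>)\<lparr>carrier := \<alpha> ` carrier G\<rparr>)
      ((BijGroup \<Omega>')\<lparr>carrier := \<beta> ` carrier G\<rparr>)"
    by (simp add: iso_def bij_betw_def)
qed

text \<open>\<open>\<beta> u w\<close> is the block containing \<open>w\<close> in a block system on
  the neighbours of \<open>u\<close>, and \<open>blk_act\<close> makes these systems compatible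
  across vertices. Nontriviality is split by its uses: \<open>blk_two\<close> serves connectedness
  of the split graph, \<open>blk_proper\<close> the growth of its vertex set.\<close>

locale local_blocks = graph_action G \<Sigma> \<phi>
  for G (structure) and \<Sigma> :: "'v pair_pre_digraph" and \<phi> :: "'a \<Rightarrow> 'v \<Rightarrow> 'v" +
  fixes \<beta> :: "'v \<Rightarrow> 'v \<Rightarrow> 'v set"
  assumes blk_self: "(u, w) \<in> parcs \<Sigma> \<Longrightarrow> w \<in> \<beta> u w"
    and blk_subset: "(u, w) \<in> parcs \<Sigma> \<Longrightarrow> \<beta> u w \<subseteq> nbrs \<Sigma> u"
    and blk_eq: "(u, w) \<in> parcs \<Sigma> \<Longrightarrow> w' \<in> \<beta> u w \<Longrightarrow> \<beta> u w' = \<beta> u w"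
    and blk_act: "g \<in> carrier G \<Longrightarrow> (u, w) \<in> parcs \<Sigma> \<Longrightarrow> \<beta> (\<phi> g u) (\<phi> g w) = \<phi> g ` \<beta> u w"
    and blk_two: "(u, w) \<in> parcs \<Sigma> \<Longrightarrow> \<exists>w'\<in>\<beta> u w. w' \<noteq> w"
    and blk_proper: "(u, w) \<in> parcs \<Sigma> \<Longrightarrow> \<exists>w'\<in>nbrs \<Sigma> u. w' \<notin> \<beta> u w"
    and nbr: "v \<in> pverts \<Sigma> \<Longrightarrow> \<exists>w. (v, w) \<in> parcs \<Sigma>"
begin

text \<open>One copy of \<open>u\<close> for each block at \<open>u\<close>. The edge on
  \<open>u\<close> and \<open>w\<close> is attached to the copy of \<open>u\<close> whose block
  contains \<open>w\<close> and to the copy of \<open>w\<close> whose block contains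
  \<open>u\<close>, so each edge has exactly one lift.\<close>

definition \<Gamma> :: "('v \<times> 'v set) pair_pre_digraph" where
  "\<Gamma> = \<lparr>pverts = {(u, \<beta> u w) | u w. (u, w) \<in> parcs \<Sigma>},
     parcs = {((u, \<beta> u w), (w, \<beta> w u)) | u w. (u, w) \<in> parcs \<Sigma>}\<rparr>"

definition \<psi> :: "'a \<Rightarrow> 'v \<times> 'v set \<Rightarrow> 'v \<times> 'v set" where
  "\<psi> g = (\<lambda>x\<in>pverts \<Gamma>. (\<phi> g (fst x), \<phi> g ` snd x))"

lemma split_vert: "(u, w) \<in> parcs \<Sigma> \<Longrightarrow> (u, \<beta> u w) \<in> pverts \<Gamma>"
  by (auto simp: \<Gamma>_def)

lemma split_vertE:
  assumes "x \<in> pverts \<Gamma>"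
  obtains u w where "(u, w) \<in> parcs \<Sigma>" "x = (u, \<beta> u w)"
  using assms by (auto simp: \<Gamma>_def)

lemma split_arc: "(u, w) \<in> parcs \<Sigma> \<Longrightarrow> ((u, \<beta> u w), (w, \<beta> w u)) \<in> parcs \<Gamma>"
  by (auto simp: \<Gamma>_def)

lemma split_arcE:
  assumes "(x, y) \<in> parcs \<Gamma>"
  obtains u w where "(u, w) \<in> parcs \<Sigma>" "x = (u, \<beta> u w)" "y = (w, \<beta> w u)"
  using assms by (auto simp: \<Gamma>_def)

lemma split_act:
  assumes "g \<in> carrier G" "(u, w) \<in> parcs \<Sigma>"
  shows "\<psi> g (u, \<beta> u w) = (\<phi> g u, \<beta> (\<phi> g u) (\<phi> g w))"
  using assms by (simp add: \<psi>_def split_vert blk_act)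

lemma split_graph: "pair_graph \<Gamma>"
proof (rule finite_pair_graphI)
  have "finite (parcs \<Sigma>)"
  proof -
    interpret pair_graph \<Sigma> by (rule graph)
    show ?thesis by (rule pair_finite_arcs)
  qed
  moreover have "pverts \<Gamma> = (\<lambda>(u, w). (u, \<beta> u w)) ` parcs \<Sigma>" by (force simp: \<Gamma>_def)
  ultimately show "finite (pverts \<Gamma>)" by simp
  show "parcs \<Gamma> \<subseteq> pverts \<Gamma> \<times> pverts \<Gamma>"
    using arc_sym split_vert by (auto elim!: split_arcE)
  show "(y, x) \<in> parcs \<Gamma>" if "(x, y) \<in> parcs \<Gamma>" for x y
    using that arc_sym split_arc by (elim split_arcE) simp
  show "x \<noteq> y" if "(x, y) \<in> parcs \<Gamma>" for x y
    using that arc_neq by (elim split_arcE) auto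
qed

lemma split_hom: "\<psi> \<in> hom G (AutGroup \<Gamma>)"
proof (rule hom_AutGroupI)
  show "group_action G (pverts \<Gamma>) \<psi>"
  proof (rule group_actionI[OF is_group])
    show "\<psi> g \<in> extensional (pverts \<Gamma>)" for g by (simp add: \<psi>_def)
    show "\<psi> g x \<in> pverts \<Gamma>" if "g \<in> carrier G" "x \<in> pverts \<Gamma>" for g x
      using that(2,1) by (elim split_vertE) (simp add: split_act split_vert act_arc)
    show "\<psi> \<one> x = x" if "x \<in> pverts \<Gamma>" for x
      using that by (elim split_vertE) (simp add: split_act V.act_one arc_verts)
    show "\<psi> (g \<otimes> h) x = \<psi> g (\<psi> h x)" if "g \<in> carrier G" "h \<in> carrier G" "x \<in> pverts \<Gamma>" for g h x
      using that(3,1,2)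
      by (elim split_vertE) (simp add: split_act act_arc V.composition_rule arc_verts)
  qed
  show "(\<psi> g x, \<psi> g y) \<in> parcs \<Gamma>" if "g \<in> carrier G" "(x, y) \<in> parcs \<Gamma>" for g x y
    using that(2,1) by (elim split_arcE) (simp add: split_act act_arc arc_sym split_arc)
qed

sublocale split: graph_action G \<Gamma> \<psi>
  by (intro graph_action.intro graph_action_axioms.intro is_group split_graph split_hom)

lemma split_mon:
  assumes "inj_on \<phi> (carrier G)"
  shows "\<psi> \<in> mon G (AutGroup \<Gamma>)"
proof -
  have "inj_on \<psi> (carrier G)"
  proof (rule inj_onI)
    fix g h assume g: "g \<in> carrier G" and h: "h \<in> carrier G" and eq: "\<psi> g = \<psi> h"
    have "\<phi> g u = \<phi> h u" if "u \<in> pverts \<Sigma>" for u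
    proof -
      obtain w where w: "(u, w) \<in> parcs \<Sigma>" using nbr[OF \<open>u \<in> pverts \<Sigma>\<close>] by blast
      then show ?thesis using split_act[OF g w] split_act[OF h w] eq by simp
    qed
    then have "\<phi> g = \<phi> h" using extensionalityI Bij_imp_extensional V.bij_prop0 g h by metis
    then show "g = h" using assms g h by (simp add: inj_on_eq_iff)
  qed
  then show ?thesis using split_hom by (simp add: mon_def)
qed

text \<open>Ranging over both ordered pairs of distinct ends avoids choosing a direction of the
  edge. Projecting to first coordinates recovers \<open>e\<close>, whence injectivity.\<close>

definition lift_edge :: "'v set \<Rightarrow> ('v \<times> 'v set) set" where
  "lift_edge e = {(x, \<beta> x y) | x y. x \<in> e \<and> y \<in> e \<and> x \<noteq> y}"

lemma lift_edge:
  "(u, w) \<in> parcs \<Sigma> \<Longrightarrow> lift_edge {u, w} = {(u, \<beta> u w), (w, \<beta> w u)}"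
  using arc_neq[of u w] by (auto simp: lift_edge_def)

lemma lift_edge_bij: "bij_betw lift_edge (edge_set \<Sigma>) (edge_set \<Gamma>)"
  unfolding bij_betw_def
proof
  have "fst ` lift_edge e = e" if "e \<in> edge_set \<Sigma>" for e
    using that by (elim edge_setE) (simp add: lift_edge)
  then show "inj_on lift_edge (edge_set \<Sigma>)" by (rule inj_on_inverseI)
  show "lift_edge ` edge_set \<Sigma> = edge_set \<Gamma>"
  proof (intro equalityI subsetI)
    fix e assume "e \<in> lift_edge ` edge_set \<Sigma>"
    then obtain u w where "(u, w) \<in> parcs \<Sigma>" "e = lift_edge {u, w}" by (auto elim!: edge_setE)
    then show "e \<in> edge_set \<Gamma>" using lift_edge split.edge_in_edge_set[OF split_arc] by simp
  next
    fix e assume "e \<in> edge_set \<Gamma>"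
    then obtain x y where "(x, y) \<in> parcs \<Gamma>" "e = {x, y}" by (rule split.edge_setE)
    then obtain u w where "(u, w) \<in> parcs \<Sigma>" "e = {(u, \<beta> u w), (w, \<beta> w u)}"
      by (elim split_arcE) blast
    then show "e \<in> lift_edge ` edge_set \<Sigma>" using lift_edge edge_in_edge_set by blast
  qed
qed

lemma lift_edge_equivariant:
  assumes g: "g \<in> carrier G" and e: "e \<in> edge_set \<Sigma>"
  shows "lift_edge (edge_action \<phi> \<Sigma> g e) = edge_action \<psi> \<Gamma> g (lift_edge e)"
proof -
  obtain u w where uw: "(u, w) \<in> parcs \<Sigma>" "e = {u, w}" using edge_setE[OF e] .
  show ?thesis
    using split.edge_action_edge[OF split_arc[OF uw(1)]] g uw
    by (simp add: lift_edge edge_action_edge act_arc split_act arc_sym)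
qed

lemma split_edge_primitive:
  assumes "edge_primitive G \<phi> \<Sigma>"
  shows "edge_primitive G \<psi> \<Gamma>"
  unfolding edge_primitive_def
proof (rule primitive_action_bij)
  show "primitive_action G (edge_set \<Sigma>) (edge_action \<phi> \<Sigma>)"
    using assms by (simp add: edge_primitive_def)
  show "group_action G (edge_set \<Gamma>) (edge_action \<psi> \<Gamma>)" by (rule split.edge.group_action_axioms)
  show "bij_betw lift_edge (edge_set \<Sigma>) (edge_set \<Gamma>)" by (rule lift_edge_bij)
  show "lift_edge (edge_action \<phi> \<Sigma> g e) = edge_action \<psi> \<Gamma> g (lift_edge e)"
    if "g \<in> carrier G" "e \<in> edge_set \<Sigma>" for g e
    using that by (rule lift_edge_equivariant)
qed

lemma split_induced_edge_group:
  "induced_edge_group G \<phi> \<Sigma> \<cong> induced_edge_group G \<psi> \<Gamma>"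
  unfolding induced_edge_group_def
proof (rule induced_groups_iso)
  show "group_action G (edge_set \<Sigma>) (edge_action \<phi> \<Sigma>)" by (rule edge.group_action_axioms)
  show "group_action G (edge_set \<Gamma>) (edge_action \<psi> \<Gamma>)" by (rule split.edge.group_action_axioms)
  show "bij_betw lift_edge (edge_set \<Sigma>) (edge_set \<Gamma>)" by (rule lift_edge_bij)
  show "lift_edge (edge_action \<phi> \<Sigma> g e) = edge_action \<psi> \<Gamma> g (lift_edge e)"
    if "g \<in> carrier G" "e \<in> edge_set \<Sigma>" for g e
    using that by (rule lift_edge_equivariant)
qed

lemma split_arc_transitive:
  assumes "arc_transitive G \<phi> \<Sigma>"
  shows "arc_transitive G \<psi> \<Gamma>"
  unfolding split.arc_transitive_iff
proof (intro allI impI)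
  fix x y x' y' assume "(x, y) \<in> parcs \<Gamma>" "(x', y') \<in> parcs \<Gamma>"
  then obtain u w u' w' where uw: "(u, w) \<in> parcs \<Sigma>" "x = (u, \<beta> u w)" "y = (w, \<beta> w u)"
    and uw': "(u', w') \<in> parcs \<Sigma>" "x' = (u', \<beta> u' w')" "y' = (w', \<beta> w' u')"
    by (elim split_arcE) blast
  obtain g where "g \<in> carrier G" "\<phi> g u = u'" "\<phi> g w = w'"
    using assms uw(1) uw'(1) unfolding arc_transitive_iff by blast
  then show "\<exists>g\<in>carrier G. \<psi> g x = x' \<and> \<psi> g y = y'"
    using uw uw' split_act[of g u w] split_act[of g w u] arc_sym[of u w] by auto
qed

lemma split_connected:
  assumes prim: "edge_primitive G \<phi> \<Sigma>"
  shows "connected (with_proj \<Gamma>)"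
proof -
  obtain u w where uw: "(u, w) \<in> parcs \<Sigma>" using edge_primitive_ex_arc[OF prim] by blast
  obtain w' where w': "w' \<in> \<beta> u w" "w' \<noteq> w" using blk_two[OF uw] by blast
  then have uw': "(u, w') \<in> parcs \<Sigma>" using blk_subset[OF uw] by (auto simp: nbrs_def)
  \<comment> \<open>Neighbours \<open>w\<close> and \<open>w'\<close> in one block belong to the
    same copy of \<open>u\<close>, which therefore carries two edges.\<close>
  have "((u, \<beta> u w), (w', \<beta> w' u)) \<in> parcs \<Gamma>"
    using split_arc[OF uw'] blk_eq[OF uw w'(1)] by simp
  moreover have "(w, \<beta> w u) \<noteq> (w', \<beta> w' u)" using w'(2) by simp
  moreover have "\<exists>y. (x, y) \<in> parcs \<Gamma>" if "x \<in> pverts \<Gamma>" for x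
    using that split_arc by (elim split_vertE) blast
  ultimately show ?thesis
    using split.edge_primitive_imp_connected[OF split_edge_primitive[OF prim] _ split_arc[OF uw]]
    by blast
qed

abbreviation P where "P \<equiv> fibres (pverts \<Gamma>) fst"

abbreviation fibre_at where "fibre_at u \<equiv> {x \<in> pverts \<Gamma>. fst x = u}"

lemma split_invariant_partition: "invariant_partition G (pverts \<Gamma>) \<psi> P"
  by (rule split.V.invariant_partition_fibres) (auto simp: kernel_invariant_def \<psi>_def)

lemma fibre_at_in: "(u, w) \<in> parcs \<Sigma> \<Longrightarrow> fibre_at u \<in> P"
  using fibre_in_fibres[OF split_vert, of u w fst] by simp

lemma fst_split_verts: "fst ` pverts \<Gamma> = pverts \<Sigma>"
proof (intro equalityI subsetI)
  fix u assume "u \<in> pverts \<Sigma>"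
  then obtain w where "(u, w) \<in> parcs \<Sigma>" using nbr by blast
  then show "u \<in> fst ` pverts \<Gamma>" using split_vert by force
qed (use arc_verts in \<open>auto elim!: split_vertE\<close>)

lemma fibre_at_bij: "bij_betw fibre_at (pverts \<Sigma>) P"
  unfolding bij_betw_def
proof
  show "inj_on fibre_at (pverts \<Sigma>)"
  proof (rule inj_onI)
    fix u v assume "u \<in> pverts \<Sigma>" "v \<in> pverts \<Sigma>" and eq: "fibre_at u = fibre_at v"
    then obtain w where "(u, w) \<in> parcs \<Sigma>" using nbr by blast
    then have "(u, \<beta> u w) \<in> fibre_at u" using split_vert by simp
    then show "u = v" unfolding eq by simp
  qed
  show "fibre_at ` pverts \<Sigma> = P"
    unfolding fst_split_verts[symmetric] fibres_def by (rule image_image)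
qed

text \<open>Arcs of \<open>\<Gamma>\<close> lie over arcs of \<open>\<Sigma>\<close> and every arc
  lifts, so collapsing the copies of each vertex returns \<open>\<Sigma>\<close> with its original
  action.\<close>

lemma split_quotient_iso:
  "equivariant_graph_iso G \<phi> \<Sigma> (block_action \<psi> P) (quotient_graph \<Gamma> P) fibre_at"
  unfolding equivariant_graph_iso_def
proof (intro conjI ballI)
  show "bij_betw fibre_at (pverts \<Sigma>) (pverts (quotient_graph \<Gamma> P))"
    using fibre_at_bij by (simp add: quotient_graph_def)
  fix u v assume u: "u \<in> pverts \<Sigma>" and v: "v \<in> pverts \<Sigma>"
  have inP: "fibre_at u \<in> P" "fibre_at v \<in> P" using fibre_at_bij u v by (auto simp: bij_betw_def)
  show "(fibre_at u, fibre_at v) \<in> parcs (quotient_graph \<Gamma> P) \<longleftrightarrow> (u, v) \<in> parcs \<Sigma>"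
  proof
    assume "(fibre_at u, fibre_at v) \<in> parcs (quotient_graph \<Gamma> P)"
    then have "\<exists>x\<in>fibre_at u. \<exists>y\<in>fibre_at v. (x, y) \<in> parcs \<Gamma>"
      unfolding quotient_graph_def pair_pre_digraph.simps mem_Collect_eq case_prod_conv by (elim conjE)
    then obtain x y where xy: "fst x = u" "fst y = v" "(x, y) \<in> parcs \<Gamma>" by blast
    show "(u, v) \<in> parcs \<Sigma>" using xy(3,1,2) by (elim split_arcE) simp
  next
    assume uv: "(u, v) \<in> parcs \<Sigma>"
    have "fibre_at u \<noteq> fibre_at v"
      using inj_onD[OF bij_betw_imp_inj_on[OF fibre_at_bij] _ u v] arc_neq[OF uv] by blast
    moreover have "(u, \<beta> u v) \<in> fibre_at u" "(v, \<beta> v u) \<in> fibre_at v"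
      using split_vert[OF uv] split_vert[OF arc_sym[OF uv]] by simp_all
    ultimately show "(fibre_at u, fibre_at v) \<in> parcs (quotient_graph \<Gamma> P)"
      unfolding quotient_graph_def pair_pre_digraph.simps mem_Collect_eq case_prod_conv
      using inP split_arc[OF uv] by blast
  qed
next
  fix g u assume g: "g \<in> carrier G" and u: "u \<in> pverts \<Sigma>"
  obtain w where w: "(u, w) \<in> parcs \<Sigma>" using nbr[OF u] by blast
  have part: "partition_on (pverts \<Gamma>) P" by (rule partition_on_fibres)
  have at: "part_of P (x, \<beta> x y) = fibre_at x" if "(x, y) \<in> parcs \<Sigma>" for x y
    by (rule part_of_eq[OF part fibre_at_in[OF that]]) (use split_vert[OF that] in simp)
  have "fibre_at (\<phi> g u) = part_of P (\<psi> g (u, \<beta> u w))"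
    using at[OF act_arc[OF g w]] split_act[OF g w] by simp
  also have "\<dots> = \<psi> g ` part_of P (u, \<beta> u w)"
    by (rule part_of_act[OF split_invariant_partition g split_vert[OF w]])
  also have "\<dots> = block_action \<psi> P g (fibre_at u)"
    using fibre_at_in[OF w] at[OF w] by (simp add: block_action_def)
  finally show "fibre_at (\<phi> g u) = block_action \<psi> P g (fibre_at u)" .
qed

text \<open>The projection onto \<open>\<Sigma>\<close> is onto but not injective:
  \<open>blk_proper\<close> gives at least two blocks, hence two copies, at
  \<open>u\<close>.\<close>

lemma split_larger:
  assumes "(u, w) \<in> parcs \<Sigma>"
  shows "card (pverts \<Sigma>) < card (pverts \<Gamma>)"
proof -
  obtain w' where w': "w' \<in> nbrs \<Sigma> u" "w' \<notin> \<beta> u w" using blk_proper[OF assms] by blast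
  then have uw': "(u, w') \<in> parcs \<Sigma>" by (simp add: nbrs_def)
  have "(u, \<beta> u w) \<noteq> (u, \<beta> u w')" using blk_self[OF uw'] w'(2) by auto
  then have "\<not> inj_on fst (pverts \<Gamma>)"
    using split_vert[OF assms] split_vert[OF uw'] unfolding inj_on_def by (metis fst_conv)
  then have "card (fst ` pverts \<Gamma>) \<noteq> card (pverts \<Gamma>)"
    using eq_card_imp_inj_on[OF split.finite_pverts] by blast
  moreover have "card (fst ` pverts \<Gamma>) \<le> card (pverts \<Gamma>)"
    by (rule card_image_le[OF split.finite_pverts])
  ultimately show ?thesis using fst_split_verts by simp
qed

end

section \<open>Transporting a block system from one vertex to all vertices\<close>

context graph_action
begin

text \<open>Quantifying over all group elements that take \<open>v\<close> to \<open>u\<close>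
  replaces a choice of representative for each \<open>u\<close>.\<close>

definition transported_block :: "'v \<Rightarrow> 'v set set \<Rightarrow> 'v \<Rightarrow> 'v \<Rightarrow> 'v set" where
  "transported_block v R u w =
     {w'. \<exists>g\<in>carrier G. \<exists>x\<in>nbrs \<Gamma> v. \<exists>x'\<in>nbrs \<Gamma> v. part_of R x = part_of R x' \<and>
        \<phi> g v = u \<and> \<phi> g x = w \<and> \<phi> g x' = w'}"

text \<open>Independence of the transporting element: a single \<open>g\<close> already yields the
  whole block, because any other candidate differs from it by an element of the stabiliser of
  \<open>v\<close>, which permutes \<open>R\<close>.\<close>

lemma transported_block_eq:
  assumes R: "invariant_partition (G\<lparr>carrier := stabilizer G \<phi> v\<rparr>) (nbrs \<Gamma> v) (local_action \<phi> \<Gamma> v) R"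
    and g: "g \<in> carrier G" and x: "x \<in> nbrs \<Gamma> v"
  shows "transported_block v R (\<phi> g v) (\<phi> g x) = \<phi> g ` part_of R x"
proof -
  have part: "partition_on (nbrs \<Gamma> v) R" using R by (simp add: invariant_partition_def)
  have v: "v \<in> pverts \<Gamma>" using x arc_verts by (auto simp: nbrs_def)
  have nV: "y \<in> pverts \<Gamma>" if "y \<in> nbrs \<Gamma> v" for y using that nbrs_subset by blast
  show ?thesis
  proof (intro equalityI subsetI)
    fix w' assume "w' \<in> \<phi> g ` part_of R x"
    then obtain x' where x': "x' \<in> part_of R x" "w' = \<phi> g x'" by blast
    moreover have "x' \<in> nbrs \<Gamma> v"
      using x'(1) part_of_in(1)[OF part x] partition_onD1[OF part] by blast
    moreover then have "part_of R x = part_of R x'" using part_of_eq_iff[OF part _ x] x'(1) by metis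
    ultimately show "w' \<in> transported_block v R (\<phi> g v) (\<phi> g x)"
      unfolding transported_block_def using g x by blast
  next
    fix w' assume "w' \<in> transported_block v R (\<phi> g v) (\<phi> g x)"
    then obtain h y y' where h: "h \<in> carrier G" "y \<in> nbrs \<Gamma> v" "y' \<in> nbrs \<Gamma> v"
      "part_of R y = part_of R y'" "\<phi> h v = \<phi> g v" "\<phi> h y = \<phi> g x" "\<phi> h y' = w'"
      unfolding transported_block_def by blast
    \<comment> \<open>As \<open>g\<close> and \<open>h\<close> agree on \<open>v\<close>, this
      quotient stabilises \<open>v\<close>; it maps the part of \<open>y\<close> to the part of
      \<open>x\<close>.\<close>
    define k where "k = inv g \<otimes> h"
    have kG: "k \<in> carrier G" using g h(1) by (simp add: k_def)
    have k: "\<phi> k z = \<phi> (inv g) (\<phi> h z)" if "z \<in> pverts \<Gamma>" for z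
      using that g h(1) by (simp add: k_def V.composition_rule)
    have k_stab: "k \<in> stabilizer G \<phi> v"
      using kG k[OF v] h(5) V.act_inv(1)[OF g v] by (simp add: stabilizer_def)
    have ky: "\<phi> k y = x" using k[OF nV[OF h(2)]] h(6) V.act_inv(1)[OF g nV[OF x]] by simp
    have act: "part_of R (\<phi> k z) = local_action \<phi> \<Gamma> v k ` part_of R z" if "z \<in> nbrs \<Gamma> v" for z
      using part_of_act[OF R _ that, of k] k_stab that by (simp add: local_action_def)
    have "part_of R (\<phi> k y') = part_of R x" using act[OF h(2)] act[OF h(3)] h(4) ky by simp
    moreover have "\<phi> k y' \<in> nbrs \<Gamma> v" by (rule stabilizer_act_nbrs[OF k_stab h(3)])
    ultimately have "\<phi> k y' \<in> part_of R x" using part_of_in(2)[OF part] by metis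
    moreover have "\<phi> g (\<phi> k y') = w'"
      using k[OF nV[OF h(3)]] h(7) V.act_inv(2)[OF g] V.act_closed[OF h(1) nV[OF h(3)]] by simp
    ultimately show "w' \<in> \<phi> g ` part_of R x" by blast
  qed
qed

lemma transported_block_local_blocks:
  assumes at: "arc_transitive G \<phi> \<Gamma>" and v: "v \<in> pverts \<Gamma>"
    and R: "nontrivial_system (G\<lparr>carrier := stabilizer G \<phi> v\<rparr>) (nbrs \<Gamma> v) (local_action \<phi> \<Gamma> v) R"
    and ne: "nbrs \<Gamma> v \<noteq> {}" and nbr: "\<And>v. v \<in> pverts \<Gamma> \<Longrightarrow> \<exists>w. (v, w) \<in> parcs \<Gamma>"
  shows "local_blocks G \<Gamma> \<phi> (transported_block v R)"
proof -
  let ?b = "transported_block v R"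
  have invR: "invariant_partition (G\<lparr>carrier := stabilizer G \<phi> v\<rparr>) (nbrs \<Gamma> v) (local_action \<phi> \<Gamma> v) R"
    using R by (simp add: nontrivial_system_def)
  then have part: "partition_on (nbrs \<Gamma> v) R" by (simp add: invariant_partition_def)
  note eq = transported_block_eq[OF invR]
  have nV: "y \<in> pverts \<Gamma>" if "y \<in> nbrs \<Gamma> v" for y using that nbrs_subset by blast
  have sub: "part_of R x \<subseteq> nbrs \<Gamma> v" if "x \<in> nbrs \<Gamma> v" for x
    using part_of_in(1)[OF part that] partition_onD1[OF part] by blast
  \<comment> \<open>One triple serves all arcs: every arc is an image of \<open>(v, x)\<close>, and
    then \<open>y\<close> provides a second element of its block and \<open>z\<close> a neighbour
    outside it.\<close>
  obtain x y z where xyz: "x \<in> nbrs \<Gamma> v" "y \<in> nbrs \<Gamma> v" "z \<in> nbrs \<Gamma> v" "x \<noteq> y"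
    "part_of R x = part_of R y" "part_of R x \<noteq> part_of R z"
    using nontrivial_systemE[OF R ne] .
  have y_in: "y \<in> part_of R x" using part_of_eq_iff[OF part xyz(2,1)] xyz(5) by metis
  have z_notin: "z \<notin> part_of R x" using part_of_eq_iff[OF part xyz(3,1)] xyz(6) by metis
  have from_x: "\<exists>g\<in>carrier G. \<phi> g v = u \<and> \<phi> g x = w" if "(u, w) \<in> parcs \<Gamma>" for u w
    using at xyz(1) that unfolding arc_transitive_iff nbrs_def by blast
  show ?thesis
  proof (intro local_blocks.intro local_blocks_axioms.intro graph_action_axioms)
    fix u w assume uw: "(u, w) \<in> parcs \<Gamma>"
    obtain g where g: "g \<in> carrier G" "\<phi> g v = u" "\<phi> g x = w" using from_x[OF uw] by blast
    have b: "?b u w = \<phi> g ` part_of R x" using eq[OF g(1) xyz(1)] g(2,3) by simp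
    have g_nbrs: "\<phi> g x' \<in> nbrs \<Gamma> u" if "x' \<in> nbrs \<Gamma> v" for x'
      using that act_arc[OF g(1), of v x'] g(2) by (simp add: nbrs_def)
    have g_inj: "x' = x''" if "\<phi> g x' = \<phi> g x''" "x' \<in> nbrs \<Gamma> v" "x'' \<in> nbrs \<Gamma> v" for x' x''
      using inj_onD[OF V.inj_prop[OF g(1)] that(1)] that(2,3) nV by blast
    show "w \<in> ?b u w" using b g(3) part_of_in(2)[OF part xyz(1)] by blast
    show "?b u w \<subseteq> nbrs \<Gamma> u"
      unfolding b by (rule image_subsetI) (rule g_nbrs[OF subsetD[OF sub[OF xyz(1)]]])
    have "\<phi> g y \<noteq> w" using g_inj[OF _ xyz(1,2)] g(3) xyz(4) by metis
    then show "\<exists>w'\<in>?b u w. w' \<noteq> w" unfolding b using y_in by (intro bexI[of _ "\<phi> g y"] imageI)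
    have "\<phi> g z \<notin> ?b u w"
    proof
      assume "\<phi> g z \<in> ?b u w"
      then obtain x' where x': "x' \<in> part_of R x" "\<phi> g z = \<phi> g x'" using b by blast
      then have "z = x'" using g_inj[OF x'(2) xyz(3)] sub[OF xyz(1)] by blast
      then show False using x'(1) z_notin by simp
    qed
    then show "\<exists>w'\<in>nbrs \<Gamma> u. w' \<notin> ?b u w" using g_nbrs[OF xyz(3)] by (rule bexI)
    show "?b u w' = ?b u w" if w': "w' \<in> ?b u w" for w'
    proof -
      obtain x' where x': "x' \<in> part_of R x" "w' = \<phi> g x'" using b w' by blast
      then have x'n: "x' \<in> nbrs \<Gamma> v" using sub[OF xyz(1)] by blast
      have "part_of R x' = part_of R x" using part_of_eq_iff[OF part x'n xyz(1)] x'(1) by blast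
      then show ?thesis using eq[OF g(1) x'n] b x'(2) g(2) by simp
    qed
    show "?b (\<phi> h u) (\<phi> h w) = \<phi> h ` ?b u w" if h: "h \<in> carrier G" for h
    proof -
      have hg: "\<phi> (h \<otimes> g) t = \<phi> h (\<phi> g t)" if "t \<in> pverts \<Gamma>" for t
        using that h g(1) by (simp add: V.composition_rule)
      have "?b (\<phi> h u) (\<phi> h w) = \<phi> (h \<otimes> g) ` part_of R x"
        using eq[OF m_closed[OF h g(1)] xyz(1)] hg[OF v] hg[OF nV[OF xyz(1)]] g(2,3) by simp
      also have "\<dots> = (\<lambda>t. \<phi> h (\<phi> g t)) ` part_of R x"
        by (rule image_cong[OF refl]) (use hg nV sub[OF xyz(1)] in blast)
      also have "\<dots> = \<phi> h ` ?b u w" using b by (simp add: image_image)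
      finally show ?thesis .
    qed
  qed (rule nbr)
qed

theorem locally_imprimitive_imp_split:
  assumes prim: "edge_primitive G \<phi> \<Gamma>" and loc: "locally_imprimitive G \<phi> \<Gamma>"
    and faithful: "inj_on \<phi> (carrier G)"
  shows "\<exists>(\<Delta> :: ('v \<times> 'v set) pair_pre_digraph) \<psi> P f.
    pair_graph \<Delta> \<and> connected (with_proj \<Delta>) \<and> \<psi> \<in> mon G (AutGroup \<Delta>) \<and>
    edge_primitive G \<psi> \<Delta> \<and> arc_transitive G \<psi> \<Delta> \<and> invariant_partition G (pverts \<Delta>) \<psi> P \<and>
    equivariant_graph_iso G \<phi> \<Gamma> (block_action \<psi> P) (quotient_graph \<Delta> P) f \<and>
    card (pverts \<Gamma>) < card (pverts \<Delta>) \<and>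
    induced_edge_group G \<phi> \<Gamma> \<cong> induced_edge_group G \<psi> \<Delta>"
proof -
  obtain v w where vw: "(v, w) \<in> parcs \<Gamma>" using edge_primitive_ex_arc[OF prim] by blast
  have conn: "connected (with_proj \<Gamma>)" by (rule locally_imprimitive_imp_connected[OF prim loc])
  have at: "arc_transitive G \<phi> \<Gamma>"
    by (rule edge_primitive_imp_arc_transitive[OF prim conn locally_imprimitive_nontrivial[OF loc vw]])
  have nbr: "\<exists>w. (v, w) \<in> parcs \<Gamma>" if "v \<in> pverts \<Gamma>" for v
    using connected_no_isolated[OF conn vw that] by blast
  obtain R where R: "nbrs \<Gamma> v \<noteq> {}"
    "nontrivial_system (G\<lparr>carrier := stabilizer G \<phi> v\<rparr>) (nbrs \<Gamma> v) (local_action \<phi> \<Gamma> v) R"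
    using loc arc_verts(1)[OF vw] unfolding locally_imprimitive_def imprimitive_action_def by blast
  interpret S: local_blocks G \<Gamma> \<phi> "transported_block v R"
    by (rule transported_block_local_blocks[OF at arc_verts(1)[OF vw] R(2,1) nbr])
  show ?thesis
    by (intro exI conjI)
      (rule S.split_graph S.split_connected[OF prim] S.split_mon[OF faithful]
        S.split_edge_primitive[OF prim] S.split_arc_transitive[OF at] S.split_invariant_partition
        S.split_quotient_iso S.split_larger[OF vw] S.split_induced_edge_group)+
qed

end

theorem theorem1p1:
  shows
    "(\<forall>(\<Gamma> :: 'v pair_pre_digraph) G.
        pair_graph \<Gamma> \<and> connected (with_proj \<Gamma>) \<and> \<not> trivial_graph \<Gamma> \<and>
        subgroup G (AutGroup \<Gamma>) \<and> edge_primitive (aut_subgroup \<Gamma> G) (\<lambda>g. g) \<Gamma>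
        \<longrightarrow> arc_transitive (aut_subgroup \<Gamma> G) (\<lambda>g. g) \<Gamma> \<and>
            (vertex_primitive (aut_subgroup \<Gamma> G) (\<lambda>g. g) \<Gamma> \<or>
             vertex_biprimitive (aut_subgroup \<Gamma> G) (\<lambda>g. g) \<Gamma> \<or>
             (\<exists>P. invariant_partition (aut_subgroup \<Gamma> G) (pverts \<Gamma>) (\<lambda>g. g) P \<and>
                  spread_of_quotient \<Gamma> P \<and>
                  pair_graph (quotient_graph \<Gamma> P) \<and>
                  block_action (\<lambda>g. g) P \<in> mon (aut_subgroup \<Gamma> G) (AutGroup (quotient_graph \<Gamma> P)) \<and>
                  edge_primitive (aut_subgroup \<Gamma> G) (block_action (\<lambda>g. g) P) (quotient_graph \<Gamma> P) \<and>
                  locally_imprimitive (aut_subgroup \<Gamma> G) (block_action (\<lambda>g. g) P)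
                    (quotient_graph \<Gamma> P)))) \<and>
     (\<forall>(\<Sigma> :: 'w pair_pre_digraph) G.
        pair_graph \<Sigma> \<and> subgroup G (AutGroup \<Sigma>) \<and>
        edge_primitive (aut_subgroup \<Sigma> G) (\<lambda>g. g) \<Sigma> \<and>
        locally_imprimitive (aut_subgroup \<Sigma> G) (\<lambda>g. g) \<Sigma>
        \<longrightarrow> (\<exists>(\<Gamma> :: ('w \<times> 'w set) pair_pre_digraph) \<phi> P f.
              pair_graph \<Gamma> \<and> connected (with_proj \<Gamma>) \<and>
              \<phi> \<in> mon (aut_subgroup \<Sigma> G) (AutGroup \<Gamma>) \<and>
              edge_primitive (aut_subgroup \<Sigma> G) \<phi> \<Gamma> \<and>
              arc_transitive (aut_subgroup \<Sigma> G) \<phi> \<Gamma> \<and>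
              invariant_partition (aut_subgroup \<Sigma> G) (pverts \<Gamma>) \<phi> P \<and>
              equivariant_graph_iso (aut_subgroup \<Sigma> G) (\<lambda>g. g) \<Sigma>
                (block_action \<phi> P) (quotient_graph \<Gamma> P) f \<and>
              card (pverts \<Sigma>) < card (pverts \<Gamma>) \<and>
              induced_edge_group (aut_subgroup \<Sigma> G) (\<lambda>g. g) \<Sigma>
                \<cong> induced_edge_group (aut_subgroup \<Sigma> G) \<phi> \<Gamma>))"
proof (intro conjI allI impI; elim conjE)
  fix \<Gamma> :: "'v pair_pre_digraph" and G
  assume graph: "pair_graph \<Gamma>" and conn: "connected (with_proj \<Gamma>)" and nontriv: "\<not> trivial_graph \<Gamma>"
    and sub: "subgroup G (AutGroup \<Gamma>)" and prim: "edge_primitive (aut_subgroup \<Gamma> G) (\<lambda>g. g) \<Gamma>"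
  interpret graph_action "aut_subgroup \<Gamma> G" \<Gamma> "\<lambda>g. g"
    by (rule graph_action_aut_subgroup[OF graph sub])
  show "arc_transitive (aut_subgroup \<Gamma> G) (\<lambda>g. g) \<Gamma>"
    by (rule edge_primitive_imp_arc_transitive[OF prim conn nontriv])
  show "vertex_primitive (aut_subgroup \<Gamma> G) (\<lambda>g. g) \<Gamma> \<or>
     vertex_biprimitive (aut_subgroup \<Gamma> G) (\<lambda>g. g) \<Gamma> \<or>
     (\<exists>P. invariant_partition (aut_subgroup \<Gamma> G) (pverts \<Gamma>) (\<lambda>g. g) P \<and>
          spread_of_quotient \<Gamma> P \<and>
          pair_graph (quotient_graph \<Gamma> P) \<and>
          block_action (\<lambda>g. g) P \<in> mon (aut_subgroup \<Gamma> G) (AutGroup (quotient_graph \<Gamma> P)) \<and>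
          edge_primitive (aut_subgroup \<Gamma> G) (block_action (\<lambda>g. g) P) (quotient_graph \<Gamma> P) \<and>
          locally_imprimitive (aut_subgroup \<Gamma> G) (block_action (\<lambda>g. g) P) (quotient_graph \<Gamma> P))"
    \<comment> \<open>Faithfulness is immediate here, as automorphisms act by the identity map on
      the group.\<close>
    using vertex_imprimitive_imp_spread[OF prim conn nontriv] by (metis inj_on_id2)
next
  fix \<Sigma> :: "'w pair_pre_digraph" and G
  assume graph: "pair_graph \<Sigma>" and sub: "subgroup G (AutGroup \<Sigma>)"
    and prim: "edge_primitive (aut_subgroup \<Sigma> G) (\<lambda>g. g) \<Sigma>"
    and loc: "locally_imprimitive (aut_subgroup \<Sigma> G) (\<lambda>g. g) \<Sigma>"
  interpret graph_action "aut_subgroup \<Sigma> G" \<Sigma> "\<lambda>g. g"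
    by (rule graph_action_aut_subgroup[OF graph sub])
  show "\<exists>(\<Gamma> :: ('w \<times> 'w set) pair_pre_digraph) \<phi> P f.
      pair_graph \<Gamma> \<and> connected (with_proj \<Gamma>) \<and>
      \<phi> \<in> mon (aut_subgroup \<Sigma> G) (AutGroup \<Gamma>) \<and>
      edge_primitive (aut_subgroup \<Sigma> G) \<phi> \<Gamma> \<and>
      arc_transitive (aut_subgroup \<Sigma> G) \<phi> \<Gamma> \<and>
      invariant_partition (aut_subgroup \<Sigma> G) (pverts \<Gamma>) \<phi> P \<and>
      equivariant_graph_iso (aut_subgroup \<Sigma> G) (\<lambda>g. g) \<Sigma>
        (block_action \<phi> P) (quotient_graph \<Gamma> P) f \<and>
      card (pverts \<Sigma>) < card (pverts \<Gamma>) \<and>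
      induced_edge_group (aut_subgroup \<Sigma> G) (\<lambda>g. g) \<Sigma>
        \<cong> induced_edge_group (aut_subgroup \<Sigma> G) \<phi> \<Gamma>"
    by (rule locally_imprimitive_imp_split[OF prim loc]) simp
qed

end
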